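(* Let $B_n$ denote the number of nonisomorphic simple arrangements of $n$ pseudolines in the Euclidean plane. There exists a constant $c > 0.2083$ such that $B_n \geq 2^{cn^2 - O(n \log n)}$. In particular, $B_n \geq 2^{0.2083\, n^2}$ for all sufficiently large $n$.
   Context: A pseudoline in the Euclidean plane is an $x$-monotone curve extending from $x=-\infty$ to $x=+\infty$. An arrangement of pseudolines is a finite family of pseudolines in which every pair intersects in exactly one point (a vertex), where they cross. The arrangement is simple if no three pseudolines pass through a common point. Two arrangements are isomorphic if there is a homeomorphism of the plane mapping one onto the other. $B_n$ is the number of isomorphism classes of simple arrangements of $n$ pseudolines. Logarithms are base $2$. *)

theory Defs
  imports "HOL-Analysis.Analysis" "HOL-Library.Landau_Symbols"
begin

text \<open>An x-monotone curve from x = -infinity to x = +infinity is the graph of a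
  continuous function from the reals to the reals; we represent a pseudoline by that function.\<close>

definition graph :: "(real \<Rightarrow> real) \<Rightarrow> (real \<times> real) set" where
  "graph f = {(x, f x) | x. True}"

definition pseudoline :: "(real \<Rightarrow> real) \<Rightarrow> bool" where
  "pseudoline f \<longleftrightarrow> continuous_on UNIV f"

definition cross_once :: "(real \<Rightarrow> real) \<Rightarrow> (real \<Rightarrow> real) \<Rightarrow> bool" where
  "cross_once f g \<longleftrightarrow> (\<exists>x. f x = g x \<and> (\<forall>y. y \<noteq> x \<longrightarrow> f y \<noteq> g y) \<and>
      (((\<forall>y<x. f y < g y) \<and> (\<forall>y>x. f y > g y)) \<or>
       ((\<forall>y<x. f y > g y) \<and> (\<forall>y>x. f y < g y))))"

definition arrangement :: "(real \<Rightarrow> real) set \<Rightarrow> bool" where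
  "arrangement A \<longleftrightarrow> finite A \<and> (\<forall>f\<in>A. pseudoline f) \<and>
     (\<forall>f\<in>A. \<forall>g\<in>A. f \<noteq> g \<longrightarrow> cross_once f g)"

definition simple_arrangement :: "(real \<Rightarrow> real) set \<Rightarrow> bool" where
  "simple_arrangement A \<longleftrightarrow> arrangement A \<and>
     \<not> (\<exists>f\<in>A. \<exists>g\<in>A. \<exists>h\<in>A. f \<noteq> g \<and> g \<noteq> h \<and> f \<noteq> h \<and>
            (\<exists>x. f x = g x \<and> g x = h x))"

definition arr_iso :: "(real \<Rightarrow> real) set \<Rightarrow> (real \<Rightarrow> real) set \<Rightarrow> bool" where
  "arr_iso A B \<longleftrightarrow> (\<exists>h k. homeomorphism (UNIV :: (real \<times> real) set) UNIV h k \<and>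
      (\<lambda>f. h ` graph f) ` A = graph ` B)"

definition B :: "nat \<Rightarrow> nat" where
  "B n = card {{A'. simple_arrangement A' \<and> card A' = n \<and> arr_iso A A'} | A.
                simple_arrangement A \<and> card A = n}"

end

(* A simple arrangement is encoded by the table of abscissae at which its pseudolines cross; a table
   is realised by pseudolines as soon as, for i < j < k, the times of ij, ik, jk are strictly monotone.
   The order type records the order of the crossings along each pseudoline. An isomorphism determines
   it up to relabelling and up to reversing single pseudolines, so B n is at least the number of order
   types divided by (2n)^n, and it suffices to count order types.

   Put an arrangement of n pseudolines across a bundle of m further ones. The crossings of the n
   pseudolines can be distributed over the m + 1 strips between the bundle lines in any way that is
   monotone along each pseudoline, and the bundle lines cross each other, arbitrarily, further to the
   right. With n = m = 2N and the n lines arranged as the odd-even transposition network, the crossings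
   of the even rounds can be delayed independently by 0, 1 or 2 strips, and each crossing of an odd
   round then has between 1 and 5 free strips. By convexity the number of distributions is at
   least 2 to the power (19/12 + 223/243) N^2 - O(N), where 19/12 < log_2 3 and 223/243 bounds the mean
   of the logarithm of the number of free strips. Hence log_2 of the number of order types satisfies
   b(4N) >= b(2N) + 2.501 N^2 - O(N), which gives the coefficient 2.501/12 > 0.2084. *)
theory Submission
  imports Defs "HOL-Real_Asymp.Real_Asymp"
begin

section \<open>Realising crossing times by pseudolines\<close>

definition ramp :: "real \<Rightarrow> real \<Rightarrow> real" where
  "ramp d x = max (- d) (min d x)"

text \<open>Wires start in one vertical order and end in the reverse one, so three of them sort
  either as ij, ik, jk or as jk, ik, ij. Only entries above the diagonal are read.\<close>

definition valid :: "nat \<Rightarrow> (nat \<Rightarrow> nat \<Rightarrow> real) \<Rightarrow> bool" where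
  "valid n \<tau> \<longleftrightarrow> (\<forall>i j k. i < j \<and> j < k \<and> k < n \<longrightarrow>
     (\<tau> i j < \<tau> i k \<and> \<tau> i k < \<tau> j k) \<or> (\<tau> j k < \<tau> i k \<and> \<tau> i k < \<tau> i j))"

definition gapped :: "nat \<Rightarrow> real \<Rightarrow> (nat \<Rightarrow> nat \<Rightarrow> real) \<Rightarrow> bool" where
  "gapped n d \<tau> \<longleftrightarrow> d > 0 \<and> (\<forall>i j k. i < j \<and> j < k \<and> k < n \<longrightarrow>
     (\<tau> i j + d \<le> \<tau> i k \<and> \<tau> i k + d \<le> \<tau> j k) \<or> (\<tau> j k + d \<le> \<tau> i k \<and> \<tau> i k + d \<le> \<tau> i j))"

text \<open>For gap at least d, whenever two wires meet all their other ramps are saturated and cancel.\<close>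

definition wire :: "nat \<Rightarrow> real \<Rightarrow> (nat \<Rightarrow> nat \<Rightarrow> real) \<Rightarrow> nat \<Rightarrow> real \<Rightarrow> real" where
  "wire n d \<tau> i x = (\<Sum>k<n. if i < k then ramp d (x - \<tau> i k)
     else if k < i then - ramp d (x - \<tau> k i) else 0)"

text \<open>Each of the finitely many triples tolerates every sufficiently small positive d, so one
  d serves them all; the filter \<open>at_right 0\<close> replaces an explicit minimum.\<close>

lemma valid_imp_gapped:
  assumes "valid n \<tau>"
  shows "\<exists>d. gapped n d \<tau>"
proof -
  let ?P = "\<lambda>d i j k. (\<tau> i j + d \<le> \<tau> i k \<and> \<tau> i k + d \<le> \<tau> j k) \<or> (\<tau> j k + d \<le> \<tau> i k \<and> \<tau> i k + d \<le> \<tau> i j)"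
  have ev: "\<forall>\<^sub>F d in at_right (0::real). ?P d i j k" if "i < j" "j < k" "k < n" for i j k
  proof -
    define e where "e = min \<bar>\<tau> i j - \<tau> i k\<bar> \<bar>\<tau> i k - \<tau> j k\<bar>"
    have v: "(\<tau> i j < \<tau> i k \<and> \<tau> i k < \<tau> j k) \<or> (\<tau> j k < \<tau> i k \<and> \<tau> i k < \<tau> i j)"
      using assms that unfolding valid_def by blast
    then have "e > 0" unfolding e_def by auto
    moreover have "?P d i j k" if "d > 0" "d < e" for d
      using v that unfolding e_def by auto
    ultimately show ?thesis unfolding eventually_at_right_field by blast
  qed
  have "\<forall>\<^sub>F d in at_right (0::real). \<forall>p\<in>{p\<in>{..<n}\<times>{..<n}\<times>{..<n}. fst p < fst (snd p) \<and> fst (snd p) < snd (snd p)}.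
      ?P d (fst p) (fst (snd p)) (snd (snd p))"
    by (intro eventually_ball_finite) (use ev in auto)
  with eventually_at_right_less[of "0::real"]
  have "\<forall>\<^sub>F d in at_right (0::real). gapped n d \<tau>"
  proof eventually_elim
    case (elim d)
    have "?P d i j k" if "i < j" "j < k" "k < n" for i j k
      using bspec[OF elim(2), of "(i,j,k)"] that by simp
    with elim(1) show ?case unfolding gapped_def by blast
  qed
  then show ?thesis using eventually_happens by force
qed

lemma gapped_imp_valid:
  assumes "gapped n d \<tau>"
  shows "valid n \<tau>"
  unfolding valid_def
proof (intro allI impI)
  fix i j k assume "i < j \<and> j < k \<and> k < n"
  then have "d > 0" "(\<tau> i j + d \<le> \<tau> i k \<and> \<tau> i k + d \<le> \<tau> j k) \<or> (\<tau> j k + d \<le> \<tau> i k \<and> \<tau> i k + d \<le> \<tau> i j)"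
    using assms unfolding gapped_def by blast+
  then show "(\<tau> i j < \<tau> i k \<and> \<tau> i k < \<tau> j k) \<or> (\<tau> j k < \<tau> i k \<and> \<tau> i k < \<tau> i j)"
    by linarith
qed

lemma continuous_ramp: "continuous_on UNIV (\<lambda>x. ramp d (x - t))"
  unfolding ramp_def by (intro continuous_intros)

lemma wire_continuous: "continuous_on UNIV (wire n d \<tau> i)"
  unfolding wire_def by (rule continuous_on_sum) (case_tac "i < k"; case_tac "k < i"; simp add: continuous_ramp continuous_on_minus)

lemma wire_bound:
  assumes "d > 0"
  shows "\<bar>wire n d \<tau> i x\<bar> \<le> n * d"
proof -
  have "\<bar>wire n d \<tau> i x\<bar> \<le> (\<Sum>k<n. d)"
    unfolding wire_def by (rule order.trans[OF sum_abs], rule sum_mono) (use assms in \<open>auto simp: ramp_def\<close>)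
  then show ?thesis by simp
qed

text \<open>The wires are compared summand by summand: every \<open>D k\<close> has weakly the sign
  of \<open>x - \<tau> i j\<close>, strictly so for k = i and k = j, and therefore so does the
  sum.\<close>

lemma wire_order:
  assumes g: "gapped n d \<tau>" and ij: "i < j" "j < n"
  shows "x > \<tau> i j \<Longrightarrow> wire n d \<tau> j x < wire n d \<tau> i x"
    and "x < \<tau> i j \<Longrightarrow> wire n d \<tau> i x < wire n d \<tau> j x"
    and "x = \<tau> i j \<Longrightarrow> wire n d \<tau> i x = wire n d \<tau> j x"
proof -
  define D where "D k = (if i < k then ramp d (x - \<tau> i k) else if k < i then - ramp d (x - \<tau> k i) else 0)
    - (if j < k then ramp d (x - \<tau> j k) else if k < j then - ramp d (x - \<tau> k j) else 0)" for k
  have sum: "wire n d \<tau> i x - wire n d \<tau> j x = (\<Sum>k<n. D k)"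
    unfolding wire_def D_def by (simp add: sum_subtractf)
  have d: "d > 0" and tri: "\<And>i j k. i < j \<Longrightarrow> j < k \<Longrightarrow> k < n \<Longrightarrow>
     (\<tau> i j + d \<le> \<tau> i k \<and> \<tau> i k + d \<le> \<tau> j k) \<or> (\<tau> j k + d \<le> \<tau> i k \<and> \<tau> i k + d \<le> \<tau> i j)"
    using g unfolding gapped_def by blast+
  have Dj: "D j = ramp d (x - \<tau> i j)" using ij by (simp add: D_def)
  have Di: "D i = ramp d (x - \<tau> i j)" using ij by (simp add: D_def)
  \<comment> \<open>If k is not between i and j, its crossings with them lie on one side of
    \<open>\<tau> i j\<close> at distance at least d; on the other side the two ramps are saturated
    and cancel. If i < k < j, the crossings lie on opposite sides and the saturated ramp dominates
    the other.\<close>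
  have sgn: "(x \<ge> \<tau> i j \<longrightarrow> D k \<ge> 0) \<and> (x \<le> \<tau> i j \<longrightarrow> D k \<le> 0)" if "k < n" for k
  proof -
    consider "k = i" | "k = j" | "k < i" | "i < k" "k < j" | "j < k" by linarith
    then show ?thesis
    proof cases
      case 1 then show ?thesis using Di d by (auto simp: ramp_def)
    next
      case 2 then show ?thesis using Dj d by (auto simp: ramp_def)
    next
      case 3
      then have "D k = ramp d (x - \<tau> k j) - ramp d (x - \<tau> k i)" using ij by (simp add: D_def)
      then show ?thesis using tri[OF 3 ij(1) ij(2)] d by (auto simp: ramp_def max_def min_def)
    next
      case 4
      then have "D k = ramp d (x - \<tau> i k) + ramp d (x - \<tau> k j)" using ij by (simp add: D_def)
      then show ?thesis using tri[OF 4 ij(2)] d by (auto simp: ramp_def max_def min_def)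
    next
      case 5
      then have "D k = ramp d (x - \<tau> i k) - ramp d (x - \<tau> j k)" using ij by (simp add: D_def)
      then show ?thesis using tri[OF ij(1) 5 that] d by (auto simp: ramp_def max_def min_def)
    qed
  qed
  show "wire n d \<tau> j x < wire n d \<tau> i x" if "x > \<tau> i j"
  proof -
    have "0 < (\<Sum>k<n. D k)"
      by (rule sum_pos2[of _ j]) (use that ij sgn d in \<open>auto simp: Dj ramp_def\<close>)
    then show ?thesis using sum by simp
  qed
  show "wire n d \<tau> i x < wire n d \<tau> j x" if "x < \<tau> i j"
  proof -
    have "0 < (\<Sum>k<n. - D k)"
      by (rule sum_pos2[of _ j]) (use that ij sgn d in \<open>auto simp: Dj ramp_def\<close>)
    then show ?thesis using sum by (simp add: sum_negf)
  qed
  show "wire n d \<tau> i x = wire n d \<tau> j x" if "x = \<tau> i j"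
  proof -
    have "(\<Sum>k<n. D k) = 0"
      by (rule sum.neutral) (use that sgn in \<open>auto intro: antisym\<close>)
    then show ?thesis using sum by simp
  qed
qed

definition crossing :: "(nat \<Rightarrow> nat \<Rightarrow> real) \<Rightarrow> nat \<Rightarrow> nat \<Rightarrow> real" where
  "crossing \<tau> i j = \<tau> (min i j) (max i j)"

lemma wire_eq_iff:
  assumes "gapped n d \<tau>" "i < n" "j < n" "i \<noteq> j"
  shows "wire n d \<tau> i x = wire n d \<tau> j x \<longleftrightarrow> x = crossing \<tau> i j"
proof -
  have *: "wire n d \<tau> a x = wire n d \<tau> b x \<longleftrightarrow> x = crossing \<tau> a b" if "a < b" "b < n" for a b
    using wire_order[OF assms(1) that, of x] that
    by (cases x "\<tau> a b" rule: linorder_cases) (simp_all add: crossing_def)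
  have "crossing \<tau> i j = crossing \<tau> j i" by (simp add: crossing_def min.commute max.commute)
  then show ?thesis using *[of i j] *[of j i] assms by (cases "i < j") auto
qed

lemma wire_cross_once:
  assumes "gapped n d \<tau>" "i < n" "j < n" "i \<noteq> j"
  shows "cross_once (wire n d \<tau> i) (wire n d \<tau> j)"
proof -
  have eq: "wire n d \<tau> i x = wire n d \<tau> j x \<longleftrightarrow> x = crossing \<tau> i j" for x
    using wire_eq_iff assms by blast
  have "(\<forall>y<crossing \<tau> i j. wire n d \<tau> i y < wire n d \<tau> j y) \<and>
         (\<forall>y>crossing \<tau> i j. wire n d \<tau> i y > wire n d \<tau> j y)" if "i < j"
    using wire_order[OF assms(1) that assms(3)] that by (simp add: crossing_def)
  moreover have "(\<forall>y<crossing \<tau> i j. wire n d \<tau> i y > wire n d \<tau> j y) \<and>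
         (\<forall>y>crossing \<tau> i j. wire n d \<tau> i y < wire n d \<tau> j y)" if "j < i"
    using wire_order[OF assms(1) that assms(2)] that by (simp add: crossing_def)
  ultimately show ?thesis
    unfolding cross_once_def eq using \<open>i \<noteq> j\<close> linorder_neqE_nat by blast
qed

lemma inj_on_wire:
  assumes "gapped n d \<tau>"
  shows "inj_on (wire n d \<tau>) {..<n}"
proof (rule inj_onI, rule ccontr)
  fix i j assume *: "i \<in> {..<n}" "j \<in> {..<n}" "wire n d \<tau> i = wire n d \<tau> j" "i \<noteq> j"
  then show False using wire_eq_iff[OF assms, of i j "crossing \<tau> i j + 1"] by auto
qed

lemma wires_simple_arrangement:
  assumes g: "gapped n d \<tau>"
  shows "simple_arrangement (wire n d \<tau> ` {..<n})"
proof -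
  have "\<not> (wire n d \<tau> i x = wire n d \<tau> j x \<and> wire n d \<tau> j x = wire n d \<tau> k x)"
    if ijk: "i < n" "j < n" "k < n" "i \<noteq> j" "j \<noteq> k" "i \<noteq> k" for i j k x
  proof
    assume "wire n d \<tau> i x = wire n d \<tau> j x \<and> wire n d \<tau> j x = wire n d \<tau> k x"
    then have x: "x = crossing \<tau> i j" "x = crossing \<tau> j k" "x = crossing \<tau> i k"
      using wire_eq_iff[OF g] ijk by metis+
    have "valid n \<tau>" using g by (rule gapped_imp_valid)
    \<comment> \<open>A triple point would give equal times to two pairs with the same least index,
      against the strict inequalities of \<open>valid\<close>.\<close>
    then have v: "\<And>i j k. i < j \<Longrightarrow> j < k \<Longrightarrow> k < n \<Longrightarrow> \<tau> i j \<noteq> \<tau> i k"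
      unfolding valid_def by (metis less_irrefl)
    consider "i < j" "j < k" | "i < k" "k < j" | "j < i" "i < k" | "j < k" "k < i" | "k < i" "i < j" | "k < j" "j < i"
      using ijk by linarith
    then show False
      by cases (use v[of i j k] v[of i k j] v[of j i k] v[of j k i] v[of k i j] v[of k j i] x ijk in
          \<open>auto simp: crossing_def min_def max_def\<close>)
  qed
  note triple = this
  have "\<not> (\<exists>f\<in>wire n d \<tau> ` {..<n}. \<exists>g\<in>wire n d \<tau> ` {..<n}. \<exists>h\<in>wire n d \<tau> ` {..<n}.
      f \<noteq> g \<and> g \<noteq> h \<and> f \<noteq> h \<and> (\<exists>x. f x = g x \<and> g x = h x))"
  proof
    assume "\<exists>f\<in>wire n d \<tau> ` {..<n}. \<exists>g\<in>wire n d \<tau> ` {..<n}. \<exists>h\<in>wire n d \<tau> ` {..<n}.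
      f \<noteq> g \<and> g \<noteq> h \<and> f \<noteq> h \<and> (\<exists>x. f x = g x \<and> g x = h x)"
    then obtain i j k x where "i < n" "j < n" "k < n" "wire n d \<tau> i \<noteq> wire n d \<tau> j"
      "wire n d \<tau> j \<noteq> wire n d \<tau> k" "wire n d \<tau> i \<noteq> wire n d \<tau> k"
      "wire n d \<tau> i x = wire n d \<tau> j x" "wire n d \<tau> j x = wire n d \<tau> k x"
      by blast
    then show False using triple[of i j k x] by metis
  qed
  moreover have "cross_once f h" if "f \<in> wire n d \<tau> ` {..<n}" "h \<in> wire n d \<tau> ` {..<n}" "f \<noteq> h" for f h
    using that wire_cross_once[OF g] by force
  then have "arrangement (wire n d \<tau> ` {..<n})"
    unfolding arrangement_def pseudoline_def using wire_continuous by blast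
  ultimately show ?thesis
    unfolding simple_arrangement_def by blast
qed

section \<open>Order types and isomorphism\<close>

text \<open>These are the local sequences: abscissae are compared only along a common pseudoline,
  because a homeomorphism need not respect the order of other crossings.\<close>

definition order_type :: "nat \<Rightarrow> (nat \<Rightarrow> nat \<Rightarrow> real) \<Rightarrow> (nat \<times> nat \<times> nat) set" where
  "order_type n \<tau> = {(i,j,k). i < n \<and> j < n \<and> k < n \<and> i \<noteq> j \<and> i \<noteq> k \<and> crossing \<tau> i j < crossing \<tau> i k}"

definition order_types :: "nat \<Rightarrow> (nat \<times> nat \<times> nat) set set" where
  "order_types n = order_type n ` {\<tau>. valid n \<tau>}"

text \<open>Pull-back along a relabelling, where \<open>\<epsilon> i\<close> says whether pseudoline
  i keeps its direction.\<close>

definition transport ::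
  "nat \<Rightarrow> (nat \<times> nat \<times> nat) set \<Rightarrow> (nat \<Rightarrow> nat) \<times> (nat \<Rightarrow> bool) \<Rightarrow> (nat \<times> nat \<times> nat) set" where
  "transport n T = (\<lambda>(\<pi>, \<epsilon>). {(i,j,k). i < n \<and> j < n \<and> k < n \<and> i \<noteq> j \<and> i \<noteq> k \<and>
     (if \<epsilon> i then (\<pi> i, \<pi> j, \<pi> k) \<in> T else (\<pi> i, \<pi> k, \<pi> j) \<in> T)})"

lemma finite_order_types: "finite (order_types n)"
proof -
  have "order_types n \<subseteq> Pow ({..<n} \<times> {..<n} \<times> {..<n})"
    unfolding order_types_def order_type_def by auto
  then show ?thesis by (rule finite_subset) simp
qed

lemma graph_inj: "graph f = graph g \<Longrightarrow> f = g"
  unfolding graph_def by (auto simp: set_eq_iff)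

text \<open>A homeomorphism carries crossings to crossings. Along one pseudoline the induced map
  \<open>u i\<close> of abscissae is a continuous injection of the line, hence strictly monotone, so
  the order of its crossings is kept or reversed. Each pseudoline may have its own direction; this
  freedom costs only a factor 2^n.\<close>

lemma arr_iso_order_type:
  assumes g: "gapped n d \<tau>" "gapped n e \<sigma>"
    and iso: "arr_iso (wire n d \<tau> ` {..<n}) (wire n e \<sigma> ` {..<n})"
  shows "\<exists>p \<in> ({..<n} \<rightarrow>\<^sub>E {..<n}) \<times> ({..<n} \<rightarrow>\<^sub>E UNIV). order_type n \<tau> = transport n (order_type n \<sigma>) p"
proof -
  let ?F = "wire n d \<tau>" and ?G = "wire n e \<sigma>"
  obtain h k where hk: "homeomorphism (UNIV :: (real \<times> real) set) UNIV h k"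
    and im: "(\<lambda>f. h ` graph f) ` ?F ` {..<n} = graph ` ?G ` {..<n}"
    using iso unfolding arr_iso_def by (elim exE conjE)
  have inj: "inj h" by (rule inj_on_inverseI[of _ k]) (rule homeomorphism_apply1[OF hk UNIV_I])
  have cont: "continuous_on UNIV h" using hk by (rule homeomorphism_cont1)
  have "\<forall>i\<in>{..<n}. \<exists>p. p < n \<and> h ` graph (?F i) = graph (?G p)"
  proof
    fix i assume "i \<in> {..<n}"
    then have "h ` graph (?F i) \<in> graph ` ?G ` {..<n}" unfolding im[symmetric] by blast
    then obtain p where "p \<in> {..<n}" "h ` graph (?F i) = graph (?G p)" by blast
    then show "\<exists>p. p < n \<and> h ` graph (?F i) = graph (?G p)" by blast
  qed
  then obtain \<pi> where "\<forall>i\<in>{..<n}. \<pi> i < n \<and> h ` graph (?F i) = graph (?G (\<pi> i))"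
    by (rule bchoice[THEN exE])
  then have \<pi>: "\<And>i. i < n \<Longrightarrow> \<pi> i < n" "\<And>i. i < n \<Longrightarrow> h ` graph (?F i) = graph (?G (\<pi> i))"
    by auto
  have \<pi>_inj: "\<pi> i \<noteq> \<pi> j" if "i < n" "j < n" "i \<noteq> j" for i j
  proof
    assume "\<pi> i = \<pi> j"
    then have "h ` graph (?F i) = h ` graph (?F j)" using \<pi>(2) that by simp
    then have "graph (?F i) = graph (?F j)" using inj_image_eq_iff[OF inj] by blast
    then have "?F i = ?F j" by (rule graph_inj)
    then show False using inj_on_wire[OF g(1)] that by (auto simp: inj_on_def)
  qed
  define u where "u i x = fst (h (x, ?F i x))" for i x
  have on: "snd (h (x, ?F i x)) = ?G (\<pi> i) (u i x)" if "i < n" for i x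
  proof -
    have "h (x, ?F i x) \<in> graph (?G (\<pi> i))" using \<pi>(2)[OF that] by (auto simp: graph_def)
    then show ?thesis unfolding u_def graph_def by auto
  qed
  have u_cross: "u i (crossing \<tau> i j) = crossing \<sigma> (\<pi> i) (\<pi> j)" if "i < n" "j < n" "i \<noteq> j" for i j
  proof -
    define x where "x = crossing \<tau> i j"
    have e: "?F i x = ?F j x" using wire_eq_iff[OF g(1) that] x_def by simp
    then have "u i x = u j x" by (simp add: u_def)
    then have "?G (\<pi> i) (u i x) = ?G (\<pi> j) (u i x)" using on[OF that(1), of x] on[OF that(2), of x] e by simp
    then show ?thesis
      using wire_eq_iff[OF g(2) \<pi>(1)[OF that(1)] \<pi>(1)[OF that(2)] \<pi>_inj[OF that]] x_def by simp
  qed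
  have mono: "strict_mono (u i) \<or> strict_antimono_on UNIV (u i)" if "i < n" for i
  proof -
    have "continuous_on UNIV (u i)"
      unfolding u_def
      by (intro continuous_on_fst continuous_on_compose2[OF cont] continuous_intros
          continuous_on_compose2[OF wire_continuous]) auto
    moreover have "inj (u i)"
    proof (rule injI)
      fix x y assume "u i x = u i y"
      then have "h (x, ?F i x) = h (y, ?F i y)" using on[OF that] by (simp add: prod_eq_iff u_def)
      then show "x = y" using inj by (simp add: inj_eq)
    qed
    ultimately show ?thesis using injective_eq_monotone_map[of UNIV "u i"] by simp
  qed
  \<comment> \<open>Restriction to \<open>{..<n}\<close> puts the pair into a finite function space
    with n^n * 2^n elements.\<close>
  define \<epsilon> where "\<epsilon> = (\<lambda>i\<in>{..<n}. strict_mono (u i))"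
  define \<pi>' where "\<pi>' = restrict \<pi> {..<n}"
  have key: "crossing \<tau> i j < crossing \<tau> i k \<longleftrightarrow>
    (if \<epsilon> i then crossing \<sigma> (\<pi> i) (\<pi> j) < crossing \<sigma> (\<pi> i) (\<pi> k) else crossing \<sigma> (\<pi> i) (\<pi> k) < crossing \<sigma> (\<pi> i) (\<pi> j))"
    if "i < n" "j < n" "k < n" "i \<noteq> j" "i \<noteq> k" for i j k
  proof (cases "strict_mono (u i)")
    case True
    then show ?thesis using that by (simp add: \<epsilon>_def u_cross[symmetric] strict_mono_less)
  next
    case False
    then have a: "strict_antimono_on UNIV (u i)" using mono that by blast
    have "u i x < u i y \<longleftrightarrow> y < x" for x y
      using monotone_onD[OF a, of x y] monotone_onD[OF a, of y x] by (cases x y rule: linorder_cases) auto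
    then show ?thesis using that False by (simp add: \<epsilon>_def u_cross[symmetric])
  qed
  have "(i,j,k) \<in> order_type n \<tau> \<longleftrightarrow> (i,j,k) \<in> transport n (order_type n \<sigma>) (\<pi>', \<epsilon>)" for i j k
  proof (cases "i < n \<and> j < n \<and> k < n \<and> i \<noteq> j \<and> i \<noteq> k")
    case True
    then have "\<pi>' i = \<pi> i" "\<pi>' j = \<pi> j" "\<pi>' k = \<pi> k" "\<pi> i < n" "\<pi> j < n" "\<pi> k < n" "\<pi> i \<noteq> \<pi> j" "\<pi> i \<noteq> \<pi> k"
      using \<pi>(1) \<pi>_inj by (auto simp: \<pi>'_def)
    with True show ?thesis using key[of i j k] by (simp add: order_type_def transport_def)
  next
    case False
    then show ?thesis by (auto simp: order_type_def transport_def)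
  qed
  then have "order_type n \<tau> = transport n (order_type n \<sigma>) (\<pi>', \<epsilon>)"
    by (intro set_eqI) (metis prod_cases3)
  moreover have "(\<pi>', \<epsilon>) \<in> ({..<n} \<rightarrow>\<^sub>E {..<n}) \<times> ({..<n} \<rightarrow>\<^sub>E UNIV)"
    using \<pi>(1) by (auto simp: \<pi>'_def \<epsilon>_def)
  ultimately show ?thesis by blast
qed

section \<open>Isomorphism classes against order types\<close>

definition iso_class :: "nat \<Rightarrow> (real \<Rightarrow> real) set \<Rightarrow> (real \<Rightarrow> real) set set" where
  "iso_class n A = {A'. simple_arrangement A' \<and> card A' = n \<and> arr_iso A A'}"

definition iso_classes :: "nat \<Rightarrow> (real \<Rightarrow> real) set set set" where
  "iso_classes n = iso_class n ` {A. simple_arrangement A \<and> card A = n}"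

lemma B_eq_card: "B n = card (iso_classes n)"
  unfolding B_def iso_classes_def iso_class_def by (rule arg_cong[where f = card]) auto

lemma arr_iso_refl: "arr_iso A A"
  unfolding arr_iso_def by (intro exI[of _ id]) (auto simp: homeomorphism_def)

lemma arr_iso_sym:
  assumes "arr_iso A A'"
  shows "arr_iso A' A"
proof -
  obtain h k where hk: "homeomorphism (UNIV :: (real \<times> real) set) UNIV h k"
    and im: "(\<lambda>f. h ` graph f) ` A = graph ` A'"
    using assms unfolding arr_iso_def by (elim exE conjE)
  have "k ` h ` S = S" for S
    by (simp add: image_image homeomorphism_apply1[OF hk UNIV_I])
  then have "(\<lambda>f. k ` graph f) ` A' = graph ` A"
    using arg_cong[OF im, of "(`) ((`) k)"] by (simp add: image_image)
  then show ?thesis unfolding arr_iso_def using homeomorphism_symD[OF hk] by blast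
qed

lemma arr_iso_trans:
  assumes "arr_iso A A'" "arr_iso A' A''"
  shows "arr_iso A A''"
proof -
  obtain h k where hk: "homeomorphism (UNIV :: (real \<times> real) set) UNIV h k"
    and im: "(\<lambda>f. h ` graph f) ` A = graph ` A'"
    using assms(1) unfolding arr_iso_def by (elim exE conjE)
  obtain h' k' where hk': "homeomorphism (UNIV :: (real \<times> real) set) UNIV h' k'"
    and im': "(\<lambda>f. h' ` graph f) ` A' = graph ` A''"
    using assms(2) unfolding arr_iso_def by (elim exE conjE)
  have "(\<lambda>f. (h' \<circ> h) ` graph f) ` A = (`) h' ` (\<lambda>f. h ` graph f) ` A"
    by (simp add: image_image image_comp[symmetric])
  also have "\<dots> = graph ` A''" using im im' by (simp add: image_image)
  finally show ?thesis unfolding arr_iso_def using homeomorphism_compose[OF hk hk'] by blast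
qed

lemma iso_class_eq: "arr_iso A A' \<Longrightarrow> iso_class n A = iso_class n A'"
  unfolding iso_class_def using arr_iso_sym arr_iso_trans by blast

text \<open>Each order type is sent to the class of one chosen arrangement realising it. Order types
  with the same class are transports of one another, which bounds the fibres by n^n * 2^n.
  Finiteness is assumed because an infinite set of classes would make \<open>B n\<close> equal to
  0.\<close>

lemma card_order_types_le:
  assumes fin: "finite (iso_classes n)"
  shows "card (order_types n) \<le> B n * (n ^ n * 2 ^ n)"
proof -
  have "\<exists>\<tau> d. order_type n \<tau> = T \<and> gapped n d \<tau>" if "T \<in> order_types n" for T
    using that valid_imp_gapped unfolding order_types_def by blast
  then obtain t d where td: "\<And>T. T \<in> order_types n \<Longrightarrow> order_type n (t T) = T"
     "\<And>T. T \<in> order_types n \<Longrightarrow> gapped n (d T) (t T)" by metis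
  define A where "A T = wire n (d T) (t T) ` {..<n}" for T
  have A: "simple_arrangement (A T)" "card (A T) = n" if "T \<in> order_types n" for T
    using wires_simple_arrangement[OF td(2)[OF that]] inj_on_wire[OF td(2)[OF that]]
    by (auto simp: A_def card_image)
  let ?P = "({..<n} \<rightarrow>\<^sub>E {..<n}) \<times> ({..<n} \<rightarrow>\<^sub>E (UNIV::bool set))"
  have finP: "finite ?P" by (intro finite_cartesian_product finite_PiE) auto
  have cardP: "card ?P = n ^ n * 2 ^ n"
    by (simp add: card_cartesian_product card_funcsetE)
  define c where "c T = iso_class n (A T)" for T
  have sub: "c ` order_types n \<subseteq> iso_classes n"
    unfolding c_def iso_classes_def using A by blast
  have fibre: "card {T \<in> order_types n. c T = C} \<le> n ^ n * 2 ^ n" for C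
  proof (cases "{T \<in> order_types n. c T = C} = {}")
    case True then show ?thesis by (simp only: card.empty)
  next
    case False
    then obtain S where S: "S \<in> order_types n" "c S = C" by blast
    have "{T \<in> order_types n. c T = C} \<subseteq> transport n S ` ?P"
    proof clarify
      fix T assume T: "T \<in> order_types n" "C = c T"
      have "A S \<in> iso_class n (A S)"
        using A[OF S(1)] arr_iso_refl by (simp add: iso_class_def)
      then have "A S \<in> iso_class n (A T)" using S T by (simp add: c_def)
      then have "arr_iso (A T) (A S)" by (simp add: iso_class_def)
      then show "T \<in> transport n S ` ?P"
        using arr_iso_order_type[OF td(2)[OF T(1)] td(2)[OF S(1)]] td(1)[OF T(1)] td(1)[OF S(1)]
        by (auto simp: A_def)
    qed
    then have "card {T \<in> order_types n. c T = C} \<le> card (transport n S ` ?P)"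
      by (intro card_mono finite_imageI finP)
    also have "\<dots> \<le> card ?P" by (rule card_image_le[OF finP])
    finally show ?thesis using cardP by simp
  qed
  have "order_types n = (\<Union>C\<in>iso_classes n. {T \<in> order_types n. c T = C})"
    using sub by auto
  then have "card (order_types n) \<le> (\<Sum>C\<in>iso_classes n. card {T \<in> order_types n. c T = C})"
    using card_UN_le[OF fin, of "\<lambda>C. {T \<in> order_types n. c T = C}"] by simp
  also have "\<dots> \<le> (\<Sum>C\<in>iso_classes n. n ^ n * 2 ^ n)" by (intro sum_mono fibre)
  finally show ?thesis by (simp add: B_eq_card)
qed

section \<open>Crossing an arrangement with a bundle\<close>

text \<open>The label of a crossing is the number of bundle lines to its left. Crossings without a
  common pseudoline can slide past one another, hence are not compared.\<close>

definition labellings :: "nat \<Rightarrow> nat \<Rightarrow> (nat \<Rightarrow> nat \<Rightarrow> int) \<Rightarrow> (nat \<times> nat \<Rightarrow> int) set" where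
  "labellings n m t = {f \<in> {(i,j). i < j \<and> j < n} \<rightarrow>\<^sub>E {0..int m}.
     \<forall>i j k l. i < j \<and> j < n \<and> k < l \<and> l < n \<and> {i,j} \<inter> {k,l} \<noteq> {} \<and> t i j < t k l \<longrightarrow> f (i,j) \<le> f (k,l)}"

definition base_time :: "real \<Rightarrow> (nat \<Rightarrow> nat \<Rightarrow> int) \<Rightarrow> (nat \<times> nat \<Rightarrow> int) \<Rightarrow> nat \<Rightarrow> nat \<Rightarrow> real" where
  "base_time L t f i j = of_int (f (i,j)) * L + of_int (t i j)"

text \<open>In strip k the old crossings use the first T units. The remaining 2n + 2 units make room
  for bundle line k, whose crossings deviate from its abscissa by at most n, by
  \<open>wire_bound\<close> with d = 1.\<close>

definition strip :: "nat \<Rightarrow> nat \<Rightarrow> real" where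
  "strip n T = real T + 2 * real n + 2"

definition abscissa :: "nat \<Rightarrow> nat \<Rightarrow> nat \<Rightarrow> real" where
  "abscissa n T k = real k * strip n T + real T + real n + 1"

text \<open>Indices below n are the old pseudolines, n, ..., n + m - 1 the bundle. Subtracting the height of the
  wire makes bundle line k meet the old pseudolines in the order in which they lie at its abscissa.\<close>

definition bundle_time ::
  "nat \<Rightarrow> nat \<Rightarrow> nat \<Rightarrow> (nat \<Rightarrow> nat \<Rightarrow> int) \<Rightarrow> (nat \<times> nat \<Rightarrow> int) \<Rightarrow> (nat \<Rightarrow> nat \<Rightarrow> real) \<Rightarrow> nat \<Rightarrow> nat \<Rightarrow> real" where
  "bundle_time n m T t f \<tau> i j =
     (if j < n then base_time (strip n T) t f i j
      else if i < n then abscissa n T (j - n) - wire n 1 (base_time (strip n T) t f) i (abscissa n T (j - n))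
      else real m * strip n T + 1 + (\<Sum>k<m. \<Sum>l<m. \<bar>\<tau> k l\<bar>) + \<tau> (i - n) (j - n))"

lemma strip_pos: "strip n T > 0"
  by (simp add: strip_def)

text \<open>Labels never decrease along a pseudoline, so adding them keeps the order given by t; as
  t is integral, distinct times on a pseudoline stay at least 1 apart.\<close>

lemma base_time_gapped:
  assumes v: "valid n (\<lambda>i j. of_int (t i j))" and f: "f \<in> labellings n m t"
  shows "gapped n 1 (base_time (strip n T) t f)"
  unfolding gapped_def
proof (intro conjI allI impI)
  fix i j k assume ijk: "i < j \<and> j < k \<and> k < n"
  have step: "base_time (strip n T) t f a b + 1 \<le> base_time (strip n T) t f c d"
    if "a < b" "b < n" "c < d" "d < n" "{a,b} \<inter> {c,d} \<noteq> {}" "t a b < t c d" for a b c d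
  proof -
    have "f (a,b) \<le> f (c,d)" using f that unfolding labellings_def by blast
    then have "of_int (f (a,b)) * strip n T \<le> of_int (f (c,d)) * strip n T"
      using strip_pos[of n T] by (intro mult_right_mono) auto
    moreover have "real_of_int (t a b) + 1 \<le> real_of_int (t c d)" using that(6) by linarith
    ultimately show ?thesis by (simp add: base_time_def)
  qed
  have "(t i j < t i k \<and> t i k < t j k) \<or> (t j k < t i k \<and> t i k < t i j)"
    using v ijk unfolding valid_def of_int_less_iff by blast
  then show "(base_time (strip n T) t f i j + 1 \<le> base_time (strip n T) t f i k \<and>
      base_time (strip n T) t f i k + 1 \<le> base_time (strip n T) t f j k) \<or>
     (base_time (strip n T) t f j k + 1 \<le> base_time (strip n T) t f i k \<and>
      base_time (strip n T) t f i k + 1 \<le> base_time (strip n T) t f i j)"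
    using step[of i j i k] step[of i k j k] step[of j k i k] step[of i k i j] ijk by auto
qed simp

lemma bundle_time_bounds:
  assumes "i < n" "n \<le> j"
  shows "bundle_time n m T t f \<tau> i j \<ge> real (j - n) * strip n T + real T + 1"
    and "bundle_time n m T t f \<tau> i j < real (Suc (j - n)) * strip n T"
proof -
  let ?F = "wire n 1 (base_time (strip n T) t f) i (abscissa n T (j - n))"
  have "\<bar>?F\<bar> \<le> real n" using wire_bound[of 1 n] by simp
  then have "?F \<le> real n" "- real n \<le> ?F" by linarith+
  moreover have "real (Suc (j - n)) * strip n T = real (j - n) * strip n T + real T + 2 * real n + 2"
    by (simp add: strip_def algebra_simps)
  moreover have "bundle_time n m T t f \<tau> i j = abscissa n T (j - n) - ?F"
    using assms by (simp add: bundle_time_def)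
  ultimately show "bundle_time n m T t f \<tau> i j \<ge> real (j - n) * strip n T + real T + 1"
    "bundle_time n m T t f \<tau> i j < real (Suc (j - n)) * strip n T"
    unfolding abscissa_def by linarith+
qed

lemma base_time_bounds:
  assumes t: "0 \<le> t i j \<and> t i j \<le> int T"
  shows "f (i,j) \<le> int k \<Longrightarrow> base_time (strip n T) t f i j \<le> real k * strip n T + real T"
    and "int k < f (i,j) \<Longrightarrow> real (Suc k) * strip n T \<le> base_time (strip n T) t f i j"
proof -
  have t: "0 \<le> real_of_int (t i j)" "real_of_int (t i j) \<le> real T" using t by auto
  show "base_time (strip n T) t f i j \<le> real k * strip n T + real T" if "f (i,j) \<le> int k"
  proof -
    have "of_int (f (i,j)) \<le> real k" using that by linarith
    then have "of_int (f (i,j)) * strip n T \<le> real k * strip n T"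
      using strip_pos[of n T] by (intro mult_right_mono) auto
    then show ?thesis using t by (simp add: base_time_def)
  qed
  show "real (Suc k) * strip n T \<le> base_time (strip n T) t f i j" if "int k < f (i,j)"
  proof -
    have "real (Suc k) \<le> of_int (f (i,j))" using that by linarith
    then have "real (Suc k) * strip n T \<le> of_int (f (i,j)) * strip n T"
      using strip_pos[of n T] by (intro mult_right_mono) auto
    then show ?thesis using t by (simp add: base_time_def)
  qed
qed

text \<open>The cases go by the number of bundle lines in the triple. With none or three, validity
  is inherited. With one, the bundle line meets i and j in the order of their heights. With two, the
  old pseudoline meets them from left to right before they cross each other.\<close>

lemma bundle_time_valid:
  assumes v: "valid n (\<lambda>i j. of_int (t i j))" and f: "f \<in> labellings n m t" and v': "valid m \<tau>"
    and t: "\<And>i j. i < j \<Longrightarrow> j < n \<Longrightarrow> 0 \<le> t i j \<and> t i j \<le> int T"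
  shows "valid (n + m) (bundle_time n m T t f \<tau>)"
  unfolding valid_def
proof (intro allI impI)
  let ?b = "bundle_time n m T t f \<tau>" and ?\<beta> = "base_time (strip n T) t f"
  fix i j k assume "i < j \<and> j < k \<and> k < n + m"
  then have ijk: "i < j" "j < k" "k < n + m" by auto
  have g: "gapped n 1 ?\<beta>" using base_time_gapped[OF v f] .
  consider "k < n" | "j < n" "n \<le> k" | "i < n" "n \<le> j" | "n \<le> i" by linarith
  then show "(?b i j < ?b i k \<and> ?b i k < ?b j k) \<or> (?b j k < ?b i k \<and> ?b i k < ?b i j)"
  proof cases
    case 1
    then show ?thesis
      using gapped_imp_valid[OF g] ijk unfolding valid_def by (simp add: bundle_time_def)
  next
    case 2
    let ?x = "abscissa n T (k - n)"
    have b: "?b i j = ?\<beta> i j" "?b i k = ?x - wire n 1 ?\<beta> i ?x" "?b j k = ?x - wire n 1 ?\<beta> j ?x"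
      using 2 ijk by (auto simp: bundle_time_def)
    note c = bundle_time_bounds[where i=i and n=n and j=k and m=m and T=T and t=t and f=f and \<tau>=\<tau>] bundle_time_bounds[where i=j and n=n and j=k and m=m and T=T and t=t and f=f and \<tau>=\<tau>]
    have x: "real (k - n) * strip n T + real T < ?x" "?x < real (Suc (k - n)) * strip n T"
      by (auto simp: abscissa_def strip_def algebra_simps)
    show ?thesis
    \<comment> \<open>If i and j have already crossed at \<open>?x\<close>, then i lies above j and
      the descending bundle line meets i first; otherwise everything is reversed.\<close>
    proof (cases "f (i,j) \<le> int (k - n)")
      case True
      then have le: "?\<beta> i j \<le> real (k - n) * strip n T + real T"
        using base_time_bounds(1)[of t i j T] t[OF ijk(1) 2(1)] by blast
      then have "wire n 1 ?\<beta> j ?x < wire n 1 ?\<beta> i ?x"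
        using wire_order(1)[OF g ijk(1) 2(1), of ?x] x by linarith
      then show ?thesis using b c le 2 ijk by auto
    next
      case False
      then have le: "real (Suc (k - n)) * strip n T \<le> ?\<beta> i j"
        using base_time_bounds(2)[of t i j T] t[OF ijk(1) 2(1)] by force
      then have "wire n 1 ?\<beta> i ?x < wire n 1 ?\<beta> j ?x"
        using wire_order(2)[OF g ijk(1) 2(1), of ?x] x by linarith
      then show ?thesis using b c le 2 ijk by auto
    qed
  next
    case 3
    have s: "strip n T > 0" by (rule strip_pos)
    have "real (Suc (j - n)) * strip n T \<le> real (k - n) * strip n T"
      using 3 ijk s by (intro mult_right_mono) auto
    then have 1: "?b i j < ?b i k"
      using bundle_time_bounds(2)[where i=i and n=n and j=j and m=m and T=T and t=t and f=f and \<tau>=\<tau>] bundle_time_bounds(1)[where i=i and n=n and j=k and m=m and T=T and t=t and f=f and \<tau>=\<tau>] 3 ijk by auto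
    have "real (Suc (k - n)) * strip n T \<le> real m * strip n T"
      using 3 ijk s by (intro mult_right_mono) auto
    then have 2: "?b i k < real m * strip n T"
      using bundle_time_bounds(2)[where i=i and n=n and j=k and m=m and T=T and t=t and f=f and \<tau>=\<tau>] 3 ijk by auto
    \<comment> \<open>The offset in \<open>bundle_time\<close> dominates every entry of
      \<open>\<tau>\<close>, which puts the crossings inside the bundle to the right of all
      strips.\<close>
    have "\<bar>\<tau> (j - n) (k - n)\<bar> \<le> (\<Sum>l<m. \<bar>\<tau> (j - n) l\<bar>)"
      by (rule member_le_sum) (use 3 ijk in auto)
    also have "\<dots> \<le> (\<Sum>k<m. \<Sum>l<m. \<bar>\<tau> k l\<bar>)"
      by (rule member_le_sum[of _ _ "\<lambda>k. \<Sum>l<m. \<bar>\<tau> k l\<bar>"]) (use 3 ijk in \<open>auto intro!: sum_nonneg\<close>)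
    finally have "real m * strip n T < ?b j k"
      using 3 ijk by (simp add: bundle_time_def)
    then show ?thesis using 1 2 by linarith
  next
    case 4
    then have "i - n < j - n" "j - n < k - n" "k - n < m" using ijk by auto
    then have "(\<tau> (i - n) (j - n) < \<tau> (i - n) (k - n) \<and> \<tau> (i - n) (k - n) < \<tau> (j - n) (k - n)) \<or>
        (\<tau> (j - n) (k - n) < \<tau> (i - n) (k - n) \<and> \<tau> (i - n) (k - n) < \<tau> (i - n) (j - n))"
      using v' unfolding valid_def by blast
    then show ?thesis using 4 ijk by (simp add: bundle_time_def)
  qed
qed

text \<open>Makes the labels readable from the order type: a crossing with label at most k ends
  before the room reserved for bundle line k, any other starts in a later strip.\<close>

lemma bundle_order_type_label:
  assumes t: "0 \<le> t i j \<and> t i j \<le> int T"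
    and ij: "i < j" "j < n" and k: "k < m"
  shows "(i, j, n + k) \<in> order_type (n + m) (bundle_time n m T t f \<tau>) \<longleftrightarrow> f (i,j) \<le> int k"
proof -
  let ?b = "bundle_time n m T t f \<tau>" and ?\<beta> = "base_time (strip n T) t f"
  have "crossing ?b i j = ?\<beta> i j" "crossing ?b i (n + k) = ?b i (n + k)"
    using ij by (auto simp: crossing_def bundle_time_def)
  then have "(i, j, n + k) \<in> order_type (n + m) ?b \<longleftrightarrow> ?\<beta> i j < ?b i (n + k)"
    using ij k by (auto simp: order_type_def)
  also have "\<dots> \<longleftrightarrow> f (i,j) \<le> int k"
    using bundle_time_bounds[where i=i and n=n and j="n + k" and m=m and T=T and t=t and f=f and \<tau>=\<tau>] base_time_bounds[where t=t and i=i and j=j and T=T and f=f and k=k and n=n] t ij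
    by (cases "f (i,j) \<le> int k") auto
  finally show ?thesis .
qed

lemma bundle_order_type_inner:
  "order_type m \<tau> = {(i,j,k). i < m \<and> j < m \<and> k < m \<and>
     (n + i, n + j, n + k) \<in> order_type (n + m) (bundle_time n m T t f \<tau>)}"
proof -
  have "crossing (bundle_time n m T t f \<tau>) (n + i) (n + j) =
      real m * strip n T + 1 + (\<Sum>k<m. \<Sum>l<m. \<bar>\<tau> k l\<bar>) + crossing \<tau> i j" for i j
    by (cases "i \<le> j") (auto simp: crossing_def bundle_time_def min_def max_def)
  then show ?thesis by (auto simp: order_type_def)
qed

lemma labellings_eqI:
  assumes "f \<in> labellings n m t" "f' \<in> labellings n m t"
    and eq: "\<And>i j k. i < j \<Longrightarrow> j < n \<Longrightarrow> k < m \<Longrightarrow> f (i,j) \<le> int k \<longleftrightarrow> f' (i,j) \<le> int k"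
  shows "f = f'"
proof -
  have f: "f \<in> {(i,j). i < j \<and> j < n} \<rightarrow>\<^sub>E {0..int m}" and f': "f' \<in> {(i,j). i < j \<and> j < n} \<rightarrow>\<^sub>E {0..int m}"
    using assms(1,2) by (auto simp: labellings_def)
  show ?thesis
  proof (rule PiE_ext[OF f f'])
    fix p assume "p \<in> {(i,j). i < j \<and> j < n}"
    then obtain i j where p: "p = (i,j)" "i < j" "j < n" by auto
    then have b: "0 \<le> f p" "f p \<le> int m" "0 \<le> f' p" "f' p \<le> int m"
      using PiE_mem[OF f, of p] PiE_mem[OF f', of p] by auto
    show "f p = f' p"
    proof (rule ccontr)
      assume "f p \<noteq> f' p"
      \<comment> \<open>The smaller of two different labels is a threshold below m that separates
        them.\<close>
      then have "nat (min (f p) (f' p)) < m" using b by linarith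
      from eq[OF p(2,3) this] show False using b p(1) \<open>f p \<noteq> f' p\<close> by (auto simp: min_def split: if_splits)
    qed
  qed
qed

lemma finite_labellings: "finite (labellings n m t)"
proof -
  have "finite {(i,j). i < j \<and> j < n}"
    by (rule finite_subset[of _ "{..<n} \<times> {..<n}"]) auto
  then have "finite ({(i,j). i < j \<and> j < n} \<rightarrow>\<^sub>E {0..int m})" by (intro finite_PiE) auto
  then show ?thesis by (rule rev_finite_subset) (auto simp: labellings_def)
qed

text \<open>The construction is injective: crossings inside the bundle are translated by a constant,
  which reveals the order type of the bundle, and the positions of the old crossings relative to the
  bundle lines reveal the labels.\<close>

lemma card_order_types_bundle:
  assumes v: "valid n (\<lambda>i j. of_int (t i j))"
    and t: "\<And>i j. i < j \<Longrightarrow> j < n \<Longrightarrow> 0 \<le> t i j \<and> t i j \<le> int T"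
  shows "card (order_types m) * card (labellings n m t) \<le> card (order_types (n + m))"
proof -
  have "\<exists>\<tau>. order_type m \<tau> = S \<and> valid m \<tau>" if "S \<in> order_types m" for S
    using that unfolding order_types_def by blast
  then obtain r where r: "\<And>S. S \<in> order_types m \<Longrightarrow> order_type m (r S) = S \<and> valid m (r S)"
    by metis
  define G where "G = (\<lambda>(S, f). order_type (n + m) (bundle_time n m T t f (r S)))"
  have "inj_on G (order_types m \<times> labellings n m t)"
  proof (rule inj_onI, clarify)
    fix S f S' f'
    assume S: "S \<in> order_types m" "S' \<in> order_types m" and f: "f \<in> labellings n m t" "f' \<in> labellings n m t"
      and eq: "G (S, f) = G (S', f')"
    have "S = S'"
      using eq bundle_order_type_inner[of m "r S" n T t f] bundle_order_type_inner[of m "r S'" n T t f'] r[OF S(1)] r[OF S(2)]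
      by (simp add: G_def)
    moreover have "f = f'"
    proof (rule labellings_eqI[OF f])
      fix i j k assume *: "i < j" "j < n" "k < m"
      show "f (i,j) \<le> int k \<longleftrightarrow> f' (i,j) \<le> int k"
        using eq t[OF *(1,2)] * bundle_order_type_label[where t=t and i=i and j=j and T=T and n=n and k=k and m=m and f=f and \<tau>="r S"]
            bundle_order_type_label[where t=t and i=i and j=j and T=T and n=n and k=k and m=m and f=f' and \<tau>="r S'"]
        by (simp add: G_def)
    qed
    ultimately show "S = S' \<and> f = f'" by blast
  qed
  moreover have "G ` (order_types m \<times> labellings n m t) \<subseteq> order_types (n + m)"
  proof clarify
    fix S f assume "S \<in> order_types m" "f \<in> labellings n m t"
    then have "valid (n + m) (bundle_time n m T t f (r S))"
      by (intro bundle_time_valid[OF v _ _ t]) (use r in auto)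
    then show "G (S, f) \<in> order_types (n + m)" by (simp add: G_def order_types_def)
  qed
  ultimately have "card (order_types m \<times> labellings n m t) \<le> card (order_types (n + m))"
    by (rule card_inj_on_le[OF _ _ finite_order_types])
  then show ?thesis by (simp add: card_cartesian_product)
qed

text \<open>A single pseudoline is put across the bundle. It has no crossings to distribute, so the
  only labelling is the function with empty domain.\<close>

lemma card_order_types_Suc: "card (order_types m) \<le> card (order_types (Suc m))"
proof -
  have "(\<lambda>_. undefined) \<in> labellings 1 m (\<lambda>i j. 0)"
    by (auto simp: labellings_def)
  then have "card (labellings 1 m (\<lambda>i j. 0)) \<noteq> 0" using finite_labellings by (metis card_0_eq empty_iff)
  then have "1 \<le> card (labellings 1 m (\<lambda>i j. 0))" by simp
  from mult_le_mono2[OF this, of "card (order_types m)"]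
  have "card (order_types m) \<le> card (order_types m) * card (labellings 1 m (\<lambda>i j. 0))" by simp
  also have "\<dots> \<le> card (order_types (1 + m))"
    by (rule card_order_types_bundle[where T = 0]) (auto simp: valid_def)
  finally show ?thesis by simp
qed

lemma card_order_types_mono: "m \<le> n \<Longrightarrow> card (order_types m) \<le> card (order_types n)"
  by (induction n rule: dec_induct) (auto intro: order.trans card_order_types_Suc)

lemma card_order_types_pos: "0 < card (order_types n)"
proof -
  have "order_type 0 (\<lambda>i j. 0) \<in> order_types 0"
    unfolding order_types_def by (simp add: valid_def)
  then have "card (order_types 0) \<noteq> 0" using finite_order_types by (metis card_0_eq empty_iff)
  then show ?thesis using card_order_types_mono[of 0 n] by simp
qed

section \<open>Strip distributions of the transposition network\<close>

text \<open>In the odd-even transposition network on 2N wires, i < j cross in round col j - row i, at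
  position col j + row i: the wires move along the diagonals and are reflected at the border.\<close>

definition row :: "nat \<Rightarrow> int" where
  "row i = (if even i then int (i div 2) else - int (i div 2) - 1)"

definition col :: "nat \<Rightarrow> nat \<Rightarrow> int" where
  "col N j = (if even j then 2 * int N - 1 - int (j div 2) else int (j div 2))"

definition step :: "nat \<Rightarrow> nat \<Rightarrow> nat \<Rightarrow> int" where
  "step N i j = col N j - row i"

definition place :: "nat \<Rightarrow> nat \<Rightarrow> nat \<Rightarrow> int" where
  "place N i j = col N j + row i"

text \<open>The parity of the middle wire decides: odd j gives the first alternative, even j the
  second.\<close>

lemma row_col_less:
  assumes "i < j" "j < k" "k < 2 * N"
  shows "(col N j < col N k \<and> row j < row i) \<or> (col N k < col N j \<and> row i < row j)"
  using assms by (cases "even i"; cases "even j"; cases "even k") (auto simp: col_def row_def elim!: evenE oddE)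

lemma step_valid: "valid (2 * N) (\<lambda>i j. of_int (step N i j))"
  unfolding valid_def
proof (intro allI impI)
  fix i j k assume "i < j \<and> j < k \<and> k < 2 * N"
  then have "(col N j < col N k \<and> row j < row i) \<or> (col N k < col N j \<and> row i < row j)"
    using row_col_less by blast
  then show "(real_of_int (step N i j) < real_of_int (step N i k) \<and> real_of_int (step N i k) < real_of_int (step N j k)) \<or>
     (real_of_int (step N j k) < real_of_int (step N i k) \<and> real_of_int (step N i k) < real_of_int (step N i j))"
    unfolding of_int_less_iff by (auto simp: step_def)
qed

lemma step_bounds:
  assumes "i < j" "j < 2 * N"
  shows "0 \<le> step N i j" "step N i j \<le> 2 * int N - 1"
  using assms by (cases "even i"; cases "even j"; auto simp: col_def row_def step_def elim!: evenE oddE)+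

lemma even_step_place: "even (step N i j + place N i j)"
  by (simp add: step_def place_def)

text \<open>A wire moves at most one position per round. With equal smaller or equal larger wires,
  \<open>step\<close> and \<open>place\<close> change by the same amount up to sign. If the common
  wire is the larger in one pair and the smaller in the other, \<open>row_col_less\<close> gives the
  row and column contributions to \<open>step\<close> the same sign.\<close>

lemma step_place_cone:
  assumes "i < j" "j < 2 * N" "k < l" "l < 2 * N" "{i,j} \<inter> {k,l} \<noteq> {}" "step N i j < step N k l"
  shows "\<bar>place N k l - place N i j\<bar> \<le> step N k l - step N i j"
proof -
  consider "i = k" | "j = l" | "j = k" | "i = l" using assms(5) by auto
  then show ?thesis
  proof cases
    case 3
    then show ?thesis using row_col_less[of i j l N] assms by (auto simp: step_def place_def)
  next
    case 4
    then show ?thesis using row_col_less[of k i j N] assms by (auto simp: step_def place_def)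
  qed (use assms in \<open>auto simp: step_def place_def\<close>)
qed

text \<open>Every grid position of the right parity carries a crossing, which later allows the
  delays to be recovered from a labelling. The column is (s + p) / 2 and the row is (p - s) /
  2.\<close>

lemma step_place_exists:
  assumes "0 \<le> s" "s \<le> 2 * int N - 1" "0 \<le> p" "p \<le> 2 * int N - 2" "even (s + p)"
  shows "\<exists>i j. i < j \<and> j < 2 * N \<and> step N i j = s \<and> place N i j = p"
proof -
  define e where "e = (s + p) div 2"
  have s: "s + p = 2 * e" using assms(5) by (simp add: e_def)
  define d where "d = p - e"
  have sp: "s = e - d" "p = e + d" using s by (auto simp: d_def)
  \<comment> \<open>This inverts \<open>row\<close> and \<open>col\<close>: nonnegative rows belong
    to even wires, columns below N to odd wires.\<close>
  define i where "i = (if d \<ge> 0 then 2 * nat d else 2 * nat (- d - 1) + 1)"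
  define j where "j = (if e < int N then 2 * nat e + 1 else 2 * nat (2 * int N - 1 - e))"
  have e: "0 \<le> e" "e \<le> 2 * int N - 1" using assms sp by linarith+
  have "row i = d" by (auto simp: i_def row_def)
  moreover have "col N j = e" using e by (auto simp: j_def col_def)
  moreover have "i < j" "j < 2 * N" using assms sp e by (auto simp: i_def j_def)
  ultimately show ?thesis using sp by (intro exI[of _ i] exI[of _ j]) (auto simp: step_def place_def)
qed

text \<open>Cell (u,v) stands for the crossing in round 2u at position 2v; an inner cell stands moreover for the
  crossing in round 2u + 1 at position 2v + 1, which lies between the four cells (u,v), ..., (u+1,v+1).\<close>

definition cells :: "nat \<Rightarrow> (int \<times> int) set" where
  "cells N = {0..<int N} \<times> {0..<int N}"

definition inner_cells :: "nat \<Rightarrow> (int \<times> int) set" where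
  "inner_cells N = {0..<int N - 1} \<times> {0..<int N - 1}"

definition slack :: "(int \<times> int \<Rightarrow> int) \<Rightarrow> int \<times> int \<Rightarrow> int set" where
  "slack w = (\<lambda>(u,v). {2 * u + max (w (u,v)) (w (u,v+1)) .. 2 * u + 2 + min (w (u+1,v)) (w (u+1,v+1))})"

text \<open>The undelayed label is the round itself. Among actual crossings the fallback
  \<open>s + 1\<close> concerns only the last round s = 2N - 1, where it gives the largest
  admissible label 2N.\<close>

definition label :: "nat \<Rightarrow> (int \<times> int \<Rightarrow> int) \<Rightarrow> (int \<times> int \<Rightarrow> int) \<Rightarrow> int \<Rightarrow> int \<Rightarrow> int" where
  "label N w z s p = (if even s then s + (if (s div 2, p div 2) \<in> cells N then w (s div 2, p div 2) else 0)
     else if (s div 2, p div 2) \<in> inner_cells N then z (s div 2, p div 2) else s + 1)"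

text \<open>Extends the delays by 0 and the odd rounds by 2u + 2 to all integer indices. The slack
  inequalities persist since delays lie between 0 and 2, so \<open>label_mono\<close> has no border
  cases.\<close>

lemma label_cases:
  assumes w: "w \<in> cells N \<rightarrow>\<^sub>E {0..2}" and z: "z \<in> PiE (inner_cells N) (slack w)"
  obtains W Z where "\<And>u v. 0 \<le> W u v \<and> W u v \<le> (2::int)"
    and "\<And>u v. 2 * u + max (W u v) (W u (v+1)) \<le> Z u v \<and> Z u v \<le> 2 * u + 2 + min (W (u+1) v) (W (u+1) (v+1))"
    and "\<And>u v. label N w z (2 * u) (2 * v) = 2 * u + W u v"
    and "\<And>u v. label N w z (2 * u + 1) (2 * v + 1) = Z u v"
proof
  define W where "W u v = (if (u,v) \<in> cells N then w (u,v) else 0)" for u v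
  define Z where "Z u v = (if (u,v) \<in> inner_cells N then z (u,v) else 2 * u + 2)" for u v
  show W: "0 \<le> W u v \<and> W u v \<le> 2" for u v
    using PiE_mem[OF w, of "(u,v)"] by (auto simp: W_def)
  show "2 * u + max (W u v) (W u (v+1)) \<le> Z u v \<and> Z u v \<le> 2 * u + 2 + min (W (u+1) v) (W (u+1) (v+1))" for u v
  proof (cases "(u,v) \<in> inner_cells N")
    case True
    then have "(u,v) \<in> cells N" "(u,v+1) \<in> cells N" "(u+1,v) \<in> cells N" "(u+1,v+1) \<in> cells N"
      by (auto simp: cells_def inner_cells_def)
    then show ?thesis using PiE_mem[OF z True] True by (simp add: W_def Z_def slack_def)
  next
    case False
    then show ?thesis using W[of u v] W[of u "v+1"] W[of "u+1" v] W[of "u+1" "v+1"] by (simp add: Z_def)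
  qed
  show "label N w z (2 * u) (2 * v) = 2 * u + W u v" for u v by (simp add: label_def W_def)
  show "label N w z (2 * u + 1) (2 * v + 1) = Z u v" for u v by (simp add: label_def Z_def)
qed

lemma label_bounds:
  assumes w: "w \<in> cells N \<rightarrow>\<^sub>E {0..2}" and z: "z \<in> PiE (inner_cells N) (slack w)"
    and s: "0 \<le> s" "s \<le> 2 * int N - 1"
  shows "0 \<le> label N w z s p" "label N w z s p \<le> 2 * int N"
proof -
  have w': "0 \<le> w c \<and> w c \<le> 2" if "c \<in> cells N" for c using PiE_mem[OF w that] by simp
  have "0 \<le> label N w z s p \<and> label N w z s p \<le> 2 * int N"
  proof (cases "even s")
    case True
    then have "s \<le> 2 * int N - 2" using s by presburger
    then show ?thesis using True w'[of "(s div 2, p div 2)"] s by (auto simp: label_def)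
  next
    case False
    show ?thesis
    proof (cases "(s div 2, p div 2) \<in> inner_cells N")
      case True
      define u v where "u = s div 2" and "v = p div 2"
      have c: "(u,v) \<in> inner_cells N" using True by (simp add: u_def v_def)
      then have g: "(u,v) \<in> cells N" "(u+1,v) \<in> cells N" "0 \<le> u" "u \<le> int N - 2"
        by (auto simp: cells_def inner_cells_def)
      have "2 * u + max (w (u,v)) (w (u,v+1)) \<le> z (u,v)" "z (u,v) \<le> 2 * u + 2 + min (w (u+1,v)) (w (u+1,v+1))"
        using PiE_mem[OF z c] by (simp_all add: slack_def)
      then have "0 \<le> z (u,v)" "z (u,v) \<le> 2 * int N"
        using w'[OF g(1)] w'[OF g(2)] g(3,4) by linarith+
      then show ?thesis using False c by (simp add: label_def u_def v_def)
    next
      case nin: False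
      then show ?thesis using False s by (simp add: label_def)
    qed
  qed
  then show "0 \<le> label N w z s p" "label N w z s p \<le> 2 * int N" by auto
qed

text \<open>In adjacent rounds the cone condition leaves only neighbours, where the claim is a slack
  inequality. Consecutive odd rounds are compared through a cell they share. In all other cases the
  distance of the rounds outweighs a delay of at most 2.\<close>

lemma label_mono:
  assumes w: "w \<in> cells N \<rightarrow>\<^sub>E {0..2}" and z: "z \<in> PiE (inner_cells N) (slack w)"
    and lt: "s < s'" and cone: "\<bar>p' - p\<bar> \<le> s' - s" and par: "even (s + p)" "even (s' + p')"
  shows "label N w z s p \<le> label N w z s' p'"
proof -
  obtain W Z where W: "\<And>u v. 0 \<le> W u v \<and> W u v \<le> (2::int)"
    and Z: "\<And>u v. 2 * u + max (W u v) (W u (v+1)) \<le> Z u v \<and> Z u v \<le> 2 * u + 2 + min (W (u+1) v) (W (u+1) (v+1))"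
    and L0: "\<And>u v. label N w z (2 * u) (2 * v) = 2 * u + W u v"
    and L1: "\<And>u v. label N w z (2 * u + 1) (2 * v + 1) = Z u v"
    using label_cases[OF w z] by metis
  consider (00) "even s" "even s'" | (01) "even s" "odd s'" | (10) "odd s" "even s'" | (11) "odd s" "odd s'" by blast
  then show ?thesis
  proof cases
    case 00
    then obtain u v u' v' where e: "s = 2 * u" "p = 2 * v" "s' = 2 * u'" "p' = 2 * v'"
      using par by (auto elim!: evenE)
    then show ?thesis using L0 W[of u v] W[of u' v'] lt by simp
  next
    case 01
    then obtain u v u' v' where e: "s = 2 * u" "p = 2 * v" "s' = 2 * u' + 1" "p' = 2 * v' + 1"
      using par by (auto elim!: evenE oddE)
    have "2 * u + W u v \<le> Z u' v'"
    proof (cases "u' = u")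
      case True
      then have "v = v' \<or> v = v' + 1" using cone e by linarith
      then show ?thesis using Z[of u' v'] True by auto
    next
      case False
      then have "u + 1 \<le> u'" using lt e by linarith
      then show ?thesis using Z[of u' v'] W[of u v] W[of u' v'] by linarith
    qed
    then show ?thesis using e L0 L1 by simp
  next
    case 10
    then obtain u v u' v' where e: "s = 2 * u + 1" "p = 2 * v + 1" "s' = 2 * u'" "p' = 2 * v'"
      using par by (auto elim!: evenE oddE)
    have "Z u v \<le> 2 * u' + W u' v'"
    proof (cases "u' = u + 1")
      case True
      then have "v' = v \<or> v' = v + 1" using cone e by linarith
      then show ?thesis using Z[of u v] True by auto
    next
      case False
      then have "u + 2 \<le> u'" using lt e by linarith
      then show ?thesis using Z[of u v] W[of "u+1" v] W[of u' v'] by linarith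
    qed
    then show ?thesis using e L0 L1 by simp
  next
    case 11
    then obtain u v u' v' where e: "s = 2 * u + 1" "p = 2 * v + 1" "s' = 2 * u' + 1" "p' = 2 * v' + 1"
      using par by (auto elim!: oddE)
    have "Z u v \<le> Z u' v'"
    proof (cases "u' = u + 1")
      case True
      then consider "v' = v" | "v' = v + 1" | "v = v' + 1" using cone e by linarith
      then show ?thesis using Z[of u v] Z[of u' v'] True by cases auto
    next
      case False
      then have "u + 2 \<le> u'" using lt e by linarith
      then show ?thesis using Z[of u v] Z[of u' v'] W[of "u+1" v] W[of u' v'] by linarith
    qed
    then show ?thesis using e L1 by simp
  qed
qed

text \<open>A choice of delays w and slack values z gives a labelling, and both can be read back
  because every cell is the position of a crossing.\<close>

lemma sum_card_slack_le:
  "(\<Sum>w\<in>cells N \<rightarrow>\<^sub>E {0..2}. \<Prod>c\<in>inner_cells N. card (slack w c)) \<le> card (labellings (2 * N) (2 * N) (step N))"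
proof -
  let ?S = "SIGMA w:(cells N \<rightarrow>\<^sub>E {0..2}). PiE (inner_cells N) (slack w)"
  define \<Phi> where "\<Phi> = (\<lambda>(w,z). \<lambda>(i,j)\<in>{(i,j). i < j \<and> j < 2 * N}. label N w z (step N i j) (place N i j))"
  have fin: "finite (cells N)" "finite (inner_cells N)" by (auto simp: cells_def inner_cells_def)
  have "card ?S = (\<Sum>w\<in>cells N \<rightarrow>\<^sub>E {0..2}. card (PiE (inner_cells N) (slack w)))"
    by (rule card_SigmaI) (auto intro!: finite_PiE fin simp: slack_def)
  also have "\<dots> = (\<Sum>w\<in>cells N \<rightarrow>\<^sub>E {0..2}. \<Prod>c\<in>inner_cells N. card (slack w c))"
    by (intro sum.cong refl card_PiE fin)
  finally have card: "card ?S = \<dots>" .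
  have "inj_on \<Phi> ?S"
  proof (rule inj_onI, clarify)
    fix w z w' z' assume w: "w \<in> cells N \<rightarrow>\<^sub>E {0..2}" "w' \<in> cells N \<rightarrow>\<^sub>E {0..2}"
      and z: "z \<in> PiE (inner_cells N) (slack w)" "z' \<in> PiE (inner_cells N) (slack w')"
      and eq: "\<Phi> (w, z) = \<Phi> (w', z')"
    have lab: "label N w z s p = label N w' z' s p"
      if sp: "0 \<le> s" "s \<le> 2 * int N - 1" "0 \<le> p" "p \<le> 2 * int N - 2" "even (s + p)" for s p
    proof -
      obtain i j where "i < j" "j < 2 * N" "step N i j = s" "place N i j = p"
        using step_place_exists[OF sp] by blast
      then show ?thesis using fun_cong[OF eq, of "(i,j)"] by (simp add: \<Phi>_def)
    qed
    have "w = w'"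
    proof (rule PiE_ext[OF w])
      fix c assume c: "c \<in> cells N"
      obtain u v where uv: "c = (u,v)" by fastforce
      with c have "0 \<le> u" "u < int N" "0 \<le> v" "v < int N" by (auto simp: cells_def)
      then show "w c = w' c" using lab[of "2 * u" "2 * v"] c uv by (simp add: label_def)
    qed
    moreover have "z = z'"
    proof (rule PiE_ext[OF z(1)])
      show "z' \<in> PiE (inner_cells N) (slack w)" using z(2) \<open>w = w'\<close> by simp
      fix c assume c: "c \<in> inner_cells N"
      obtain u v where uv: "c = (u,v)" by fastforce
      with c have "0 \<le> u" "u < int N - 1" "0 \<le> v" "v < int N - 1" by (auto simp: inner_cells_def)
      then show "z c = z' c" using lab[of "2 * u + 1" "2 * v + 1"] c uv by (simp add: label_def)
    qed
    ultimately show "w = w' \<and> z = z'" by blast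
  qed
  moreover have "\<Phi> ` ?S \<subseteq> labellings (2 * N) (2 * N) (step N)"
  proof clarify
    fix w z assume w: "w \<in> cells N \<rightarrow>\<^sub>E {0..2}" and z: "z \<in> PiE (inner_cells N) (slack w)"
    have "\<Phi> (w, z) \<in> {(i,j). i < j \<and> j < 2 * N} \<rightarrow>\<^sub>E {0..int (2 * N)}"
      unfolding \<Phi>_def using label_bounds[OF w z step_bounds] by auto
    moreover have "\<Phi> (w, z) (i,j) \<le> \<Phi> (w, z) (k,l)"
      if "i < j" "j < 2 * N" "k < l" "l < 2 * N" "{i,j} \<inter> {k,l} \<noteq> {}" "step N i j < step N k l" for i j k l
      using label_mono[OF w z that(6) step_place_cone[OF that] even_step_place even_step_place] that
      by (simp add: \<Phi>_def)
    ultimately show "\<Phi> (w, z) \<in> labellings (2 * N) (2 * N) (step N)"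
      unfolding labellings_def by blast
  qed
  ultimately have "card ?S \<le> card (labellings (2 * N) (2 * N) (step N))"
    by (rule card_inj_on_le[OF _ _ finite_labellings])
  then show ?thesis using card by simp
qed

section \<open>Averaging over the delays\<close>

lemma sum_PiE_insert:
  assumes "c \<notin> A"
  shows "(\<Sum>w\<in>insert c A \<rightarrow>\<^sub>E V. F w) = (\<Sum>a\<in>V. \<Sum>w\<in>A \<rightarrow>\<^sub>E V. F (w(c := a)))"
proof -
  have "insert c A \<rightarrow>\<^sub>E V = (\<lambda>(a, w). w(c := a)) ` (V \<times> (A \<rightarrow>\<^sub>E V))"
    by (rule PiE_insert_eq)
  moreover have "inj_on (\<lambda>(a, w). w(c := a)) (V \<times> (A \<rightarrow>\<^sub>E V))"
    using inj_combinator[OF assms, of "\<lambda>_. V"] by simp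
  ultimately show ?thesis
    by (simp add: sum.reindex sum.cartesian_product case_prod_unfold)
qed

text \<open>For uniformly random w the values at four distinct cells are independent and uniform;
  the means are compared without division.\<close>

lemma sum_PiE_four:
  fixes H :: "'b \<Rightarrow> 'b \<Rightarrow> 'b \<Rightarrow> 'b \<Rightarrow> real"
  assumes "finite A" "{c1, c2, c3, c4} \<subseteq> A" "distinct [c1, c2, c3, c4]"
  shows "(\<Sum>w\<in>A \<rightarrow>\<^sub>E V. H (w c1) (w c2) (w c3) (w c4)) * real (card V) ^ 4 =
    real (card (A \<rightarrow>\<^sub>E V)) * (\<Sum>a\<in>V. \<Sum>b\<in>V. \<Sum>c\<in>V. \<Sum>d\<in>V. H a b c d)"
proof -
  define R where "R = A - {c1, c2, c3, c4}"
  have A: "A = insert c1 (insert c2 (insert c3 (insert c4 R)))" using assms(2) by (auto simp: R_def)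
  have fin: "finite R" using assms(1) by (simp add: R_def)
  have notin: "c1 \<notin> insert c2 (insert c3 (insert c4 R))" "c2 \<notin> insert c3 (insert c4 R)" "c3 \<notin> insert c4 R" "c4 \<notin> R"
    using assms(3) by (auto simp: R_def)
  have neq: "c2 \<noteq> c1" "c3 \<noteq> c1" "c4 \<noteq> c1" "c3 \<noteq> c2" "c4 \<noteq> c2" "c4 \<noteq> c3" using assms(3) by auto
  have "card A = card R + 4" unfolding A using fin notin by simp
  then have card: "card (A \<rightarrow>\<^sub>E V) = card (R \<rightarrow>\<^sub>E V) * card V ^ 4"
    using fin assms(1) by (simp add: card_funcsetE power_add)
  have "(\<Sum>w\<in>A \<rightarrow>\<^sub>E V. H (w c1) (w c2) (w c3) (w c4)) =
      (\<Sum>a\<in>V. \<Sum>b\<in>V. \<Sum>c\<in>V. \<Sum>d\<in>V. \<Sum>w\<in>R \<rightarrow>\<^sub>E V. H a b c d)"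
    unfolding A using notin neq by (simp add: sum_PiE_insert)
  also have "\<dots> = real (card (R \<rightarrow>\<^sub>E V)) * (\<Sum>a\<in>V. \<Sum>b\<in>V. \<Sum>c\<in>V. \<Sum>d\<in>V. H a b c d)"
    by (simp add: sum_distrib_left)
  finally show ?thesis by (simp add: card)
qed

text \<open>Jensen's inequality for 2^y. The tangent at the mean lies below the graph by 1 + x \<le>
  exp x, and on summation its linear terms cancel.\<close>

lemma sum_powr_ge_mean:
  fixes y :: "'a \<Rightarrow> real"
  assumes "finite W" "W \<noteq> {}"
  shows "real (card W) * 2 powr ((\<Sum>w\<in>W. y w) / card W) \<le> (\<Sum>w\<in>W. 2 powr y w)"
proof -
  define \<mu> where "\<mu> = (\<Sum>w\<in>W. y w) / card W"
  have pos: "real (card W) > 0" using assms by (simp add: card_gt_0_iff)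
  have "2 powr \<mu> * (1 + (y w - \<mu>) * ln 2) \<le> 2 powr y w" for w
  proof -
    have "2 powr \<mu> * (1 + (y w - \<mu>) * ln 2) \<le> 2 powr \<mu> * 2 powr (y w - \<mu>)"
      using exp_ge_add_one_self[of "(y w - \<mu>) * ln 2"] by (intro mult_left_mono) (auto simp: powr_def)
    then show ?thesis by (simp add: powr_add[symmetric])
  qed
  then have "(\<Sum>w\<in>W. 2 powr \<mu> * (1 + (y w - \<mu>) * ln 2)) \<le> (\<Sum>w\<in>W. 2 powr y w)" by (intro sum_mono)
  moreover have "(\<Sum>w\<in>W. 2 powr \<mu> * (1 + (y w - \<mu>) * ln 2)) =
      2 powr \<mu> * (real (card W) + ((\<Sum>w\<in>W. y w) - real (card W) * \<mu>) * ln 2)"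
    by (simp add: sum_distrib_left[symmetric] sum.distrib sum_distrib_right[symmetric] sum_subtractf)
  moreover have "real (card W) * \<mu> = (\<Sum>w\<in>W. y w)" using pos by (simp add: \<mu>_def)
  ultimately show ?thesis by (simp add: \<mu>_def[symmetric] mult.commute)
qed

text \<open>Rational lower bounds for log_2 k, exact for 1, 2 and 4. The others come from 2^19 <
  3^12 and 2^9 < 5^4.\<close>

definition log_bound :: "int \<Rightarrow> real" where
  "log_bound k = (if k = 2 then 1 else if k = 3 then 19/12 else if k = 4 then 2 else if k = 5 then 9/4 else 0)"

lemma two_powr_19_12: "2 powr (19/12) \<le> (3::real)"
proof -
  have "(2 powr (19/12)) ^ 12 = (2::real) powr 19" by (simp add: powr_power)
  also have "\<dots> = 2 ^ 19" by (simp add: powr_numeral)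
  also have "\<dots> \<le> (3::real) ^ 12" by simp
  finally show ?thesis by (rule power_le_imp_le_base[of _ 11, simplified]) simp
qed

lemma two_powr_9_4: "2 powr (9/4) \<le> (5::real)"
proof -
  have "(2 powr (9/4)) ^ 4 = (2::real) powr 9" by (simp add: powr_power)
  also have "\<dots> = 2 ^ 9" by (simp add: powr_numeral)
  also have "\<dots> \<le> (5::real) ^ 4" by simp
  finally show ?thesis by (rule power_le_imp_le_base[of _ 3, simplified]) simp
qed

lemma two_powr_log_bound:
  assumes "1 \<le> k" "k \<le> 5"
  shows "2 powr log_bound k \<le> of_int k"
proof -
  have "k = 1 \<or> k = 2 \<or> k = 3 \<or> k = 4 \<or> k = 5" using assms by linarith
  then show ?thesis using two_powr_19_12 two_powr_9_4
    by (elim disjE) (simp_all add: log_bound_def powr_numeral)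
qed

text \<open>Of the 81 quadruples, 25, 30, 19, 6 and 1 leave 1, 2, 3, 4 and 5 free strips. Division
  by 81 gives the mean 223/243.\<close>

lemma sum_log_bound:
  "(\<Sum>a\<in>{0..2::int}. \<Sum>b\<in>{0..2}. \<Sum>c\<in>{0..2}. \<Sum>d\<in>{0..2}. log_bound (3 + min c d - max a b)) = 223 / 3"
proof -
  have "{0..2::int} = {0,1,2}" by auto
  then show ?thesis by (simp add: log_bound_def)
qed

text \<open>The sum over w is the number 3^(N^2) of delay functions times the mean of the product of
  slack sizes. Jensen bounds that mean from below by 2 to the expected sum of logarithms.\<close>

lemma card_labellings_ge:
  assumes "N \<ge> 1"
  shows "2 powr (19/12 * (real N)\<^sup>2 + 223/243 * (real N - 1)\<^sup>2) \<le> real (card (labellings (2 * N) (2 * N) (step N)))"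
proof -
  define W where "W = cells N \<rightarrow>\<^sub>E {0..2::int}"
  define h where "h w = (\<lambda>(u,v). log_bound (3 + min (w (u+1,v)) (w (u+1,v+1)) - max (w (u,v)) (w (u,v+1))))"
    for w :: "int \<times> int \<Rightarrow> int"
  have fin: "finite (cells N)" "finite (inner_cells N)" by (auto simp: cells_def inner_cells_def)
  have cc: "card (cells N) = N ^ 2" by (simp add: cells_def card_cartesian_product power2_eq_square)
  have ci: "real (card (inner_cells N)) = (real N - 1)\<^sup>2"
    using assms by (simp add: inner_cells_def card_cartesian_product power2_eq_square nat_diff_distrib of_nat_diff)
  have cW: "card W = 3 ^ (N ^ 2)" unfolding W_def by (simp add: card_funcsetE fin cc)
  have finW: "finite W" unfolding W_def by (intro finite_PiE fin) auto
  have W0: "W \<noteq> {}" using cW finW by (metis card.empty power_not_zero zero_neq_numeral)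
  have nbr: "(u,v) \<in> cells N" "(u,v+1) \<in> cells N" "(u+1,v) \<in> cells N" "(u+1,v+1) \<in> cells N"
    if "(u,v) \<in> inner_cells N" for u v
    using that by (auto simp: cells_def inner_cells_def)
  have slack_ge: "2 powr h w c \<le> real (card (slack w c))" if w: "w \<in> W" and c: "c \<in> inner_cells N" for w c
  proof -
    obtain u v where uv: "c = (u,v)" by fastforce
    have b: "0 \<le> w d \<and> w d \<le> 2" if "d \<in> cells N" for d
      using PiE_mem[OF w[unfolded W_def] that] by simp
    define k where "k = 3 + min (w (u+1,v)) (w (u+1,v+1)) - max (w (u,v)) (w (u,v+1))"
    have k: "1 \<le> k" "k \<le> 5"
      using b[OF nbr(1)[OF c[unfolded uv]]] b[OF nbr(2)[OF c[unfolded uv]]]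
        b[OF nbr(3)[OF c[unfolded uv]]] b[OF nbr(4)[OF c[unfolded uv]]]
      unfolding k_def by linarith+
    have "card (slack w c) = nat k" by (simp add: slack_def uv k_def algebra_simps)
    moreover have "h w c = log_bound k" by (simp add: h_def uv k_def)
    ultimately show ?thesis using two_powr_log_bound[OF k] k by simp
  qed
  have mean: "(\<Sum>w\<in>W. h w c) = real (card W) * (223/243)" if c: "c \<in> inner_cells N" for c
  proof -
    obtain u v where uv: "c = (u,v)" by fastforce
    have "(\<Sum>w\<in>W. h w c) * real (card {0..2::int}) ^ 4 = real (card W) * (223 / 3)"
      unfolding W_def uv h_def prod.case sum_log_bound[symmetric]
      by (rule sum_PiE_four[where H = "\<lambda>a b c d. log_bound (3 + min c d - max a b)"])
        (use fin nbr[OF c[unfolded uv]] in auto)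
    then show ?thesis by simp
  qed
  \<comment> \<open>Only expectations are added, so the overlap of the neighbourhoods of different
    inner cells causes no loss.\<close>
  have "(\<Sum>w\<in>W. \<Sum>c\<in>inner_cells N. h w c) = (\<Sum>c\<in>inner_cells N. \<Sum>w\<in>W. h w c)" by (rule sum.swap)
  also have "\<dots> = real (card W) * (223/243 * (real N - 1)\<^sup>2)"
    by (simp add: mean ci[symmetric])
  finally have tot: "(\<Sum>w\<in>W. \<Sum>c\<in>inner_cells N. h w c) / real (card W) = 223/243 * (real N - 1)\<^sup>2"
    using W0 finW by simp
  have "2 powr (19/12 * (real N)\<^sup>2) = (2 powr (19/12)) ^ (N ^ 2)"
    by (simp add: powr_power mult.commute)
  also have "\<dots> \<le> real (card W)" unfolding cW using two_powr_19_12 by (simp add: power_mono)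
  finally have "2 powr (19/12 * (real N)\<^sup>2 + 223/243 * (real N - 1)\<^sup>2) \<le> real (card W) * 2 powr (223/243 * (real N - 1)\<^sup>2)"
    unfolding powr_add by (intro mult_right_mono) auto
  also have "\<dots> \<le> (\<Sum>w\<in>W. 2 powr (\<Sum>c\<in>inner_cells N. h w c))"
    using sum_powr_ge_mean[OF finW W0, of "\<lambda>w. \<Sum>c\<in>inner_cells N. h w c"] by (simp add: tot)
  also have "\<dots> \<le> (\<Sum>w\<in>W. \<Prod>c\<in>inner_cells N. real (card (slack w c)))"
    by (intro sum_mono) (use slack_ge fin in \<open>auto simp: powr_sum intro!: prod_mono\<close>)
  also have "\<dots> = real (\<Sum>w\<in>W. \<Prod>c\<in>inner_cells N. card (slack w c))" by simp
  also have "\<dots> \<le> real (card (labellings (2 * N) (2 * N) (step N)))"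
    using sum_card_slack_le[of N] unfolding W_def of_nat_le_iff .
  finally show ?thesis .
qed

text \<open>Strong induction passing from 2N to 4N with N = n div 4. The quadratic terms close
  because 12 * 0.2084 = 2.5008 is below 19/12 + 223/243; the term 5n pays for rounding n down to 4N
  and for the cells lost at the border.\<close>

lemma card_order_types_ge:
  "2 powr (0.2084 * (real n)\<^sup>2 - 5 * real n) \<le> real (card (order_types n))"
proof (induction n rule: less_induct)
  case (less n)
  define N where "N = n div 4"
  show ?case
  proof (cases "N = 0")
    case True
    then have "real n \<le> 3" unfolding N_def by linarith
    then have "real n * (0.2084 * real n - 5) \<le> 0" by (intro mult_nonneg_nonpos) auto
    then have "0.2084 * (real n)\<^sup>2 - 5 * real n \<le> 0" by (simp add: power2_eq_square algebra_simps)
    then have "2 powr (0.2084 * (real n)\<^sup>2 - 5 * real n) \<le> 2 powr 0" by (intro powr_mono) auto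
    also have "\<dots> \<le> real (card (order_types n))" using card_order_types_pos[of n] by simp
    finally show ?thesis .
  next
    case False
    have bounds: "0 \<le> step N i j \<and> step N i j \<le> int (2 * N)" if "i < j" "j < 2 * N" for i j
      using step_bounds[OF that] by simp
    have n: "4 * N \<le> n" "n \<le> 4 * N + 3" unfolding N_def by linarith+
    have x: "1 \<le> real N" "4 * real N \<le> real n" "real n \<le> 4 * real N + 3" using False n by linarith+
    have "(real n)\<^sup>2 \<le> (4 * real N + 3)\<^sup>2" using x by (intro power_mono) auto
    then have sq: "(real n)\<^sup>2 \<le> 16 * (real N)\<^sup>2 + 24 * real N + 9" by (simp add: power2_eq_square algebra_simps)
    have "0.2084 * (real n)\<^sup>2 - 5 * real n \<le>
        (0.2084 * (real (2 * N))\<^sup>2 - 5 * real (2 * N)) + (19/12 * (real N)\<^sup>2 + 223/243 * (real N - 1)\<^sup>2)"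
    proof -
      have e: "(2 * real N)\<^sup>2 = 4 * (real N)\<^sup>2" "(real N - 1)\<^sup>2 = (real N)\<^sup>2 - 2 * real N + 1"
        "real (2 * N) = 2 * real N" by (simp_all add: power2_eq_square algebra_simps)
      \<comment> \<open>With 521/2500 = 0.2084, the squares of n and N abstracted to y and q, the
        inequality is linear.\<close>
      have "521/2500 * y - 5 * z \<le> 521/2500 * (4 * q) - 5 * (2 * a) + (19/12 * q + 223/243 * (q - 2 * a + 1))"
        if "y \<le> 16 * q + 24 * a + 9" "1 \<le> a" "4 * a \<le> z" "0 \<le> q" for y z q a :: real
        using that by argo
      from this[OF sq x(1,2)] show ?thesis unfolding e by simp
    qed
    then have "2 powr (0.2084 * (real n)\<^sup>2 - 5 * real n) \<le>
       2 powr (0.2084 * (real (2 * N))\<^sup>2 - 5 * real (2 * N)) * 2 powr (19/12 * (real N)\<^sup>2 + 223/243 * (real N - 1)\<^sup>2)"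
      by (simp add: powr_add[symmetric])
    also have "\<dots> \<le> real (card (order_types (2 * N))) * real (card (labellings (2 * N) (2 * N) (step N)))"
      by (intro mult_mono less.IH card_labellings_ge) (use False n in auto)
    also have "\<dots> \<le> real (card (order_types (2 * N + 2 * N)))"
      unfolding of_nat_mult[symmetric] of_nat_le_iff
      by (rule card_order_types_bundle[where T = "2 * N", OF step_valid bounds])
    also have "\<dots> \<le> real (card (order_types n))"
      unfolding of_nat_le_iff by (rule card_order_types_mono) (use n in simp)
    finally show ?thesis .
  qed
qed

section \<open>Finitely many isomorphism classes\<close>

text \<open>Piecewise linear interpolation from the nodes \<open>a m\<close> to the nodes
  \<open>b m\<close>, with slope 1 beyond the end nodes. Written as a sum over the gaps, it remains
  meaningful when nodes collide, and continuity in the nodes can be checked gap by gap.\<close>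

definition bend :: "nat \<Rightarrow> (nat \<Rightarrow> real) \<Rightarrow> (nat \<Rightarrow> real) \<Rightarrow> real \<Rightarrow> real" where
  "bend p a b y = b 0 + min (y - a 0) 0 +
     (\<Sum>m<p. (b (Suc m) - b m) / (a (Suc m) - a m) * max 0 (min (y - a m) (a (Suc m) - a m))) + max (y - a p) 0"

definition comonotone :: "nat \<Rightarrow> (nat \<Rightarrow> real) \<Rightarrow> (nat \<Rightarrow> real) \<Rightarrow> bool" where
  "comonotone p a b \<longleftrightarrow> (\<forall>m<p. (a m < a (Suc m) \<and> b m < b (Suc m)) \<or> (a m = a (Suc m) \<and> b m = b (Suc m)))"

lemma comonotone_le:
  assumes "comonotone p a b" "k \<le> l" "l \<le> p"
  shows "a k \<le> a l"
  using assms(2,3)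
proof (induction l rule: dec_induct)
  case (step q)
  then have "a q \<le> a (Suc q)" using assms(1) unfolding comonotone_def by (metis Suc_le_lessD less_imp_le order_refl)
  then show ?case using step by simp
qed simp

text \<open>At node k every gap before k contributes its full height and every later gap nothing, so
  the sum telescopes.\<close>

lemma bend_node:
  assumes c: "comonotone p a b" and k: "k \<le> p"
  shows "bend p a b (a k) = b k"
proof -
  have "(\<Sum>m<p. (b (Suc m) - b m) / (a (Suc m) - a m) * max 0 (min (a k - a m) (a (Suc m) - a m))) =
      (\<Sum>m<p. if m < k then b (Suc m) - b m else 0)"
  proof (rule sum.cong[OF refl])
    fix m assume "m \<in> {..<p}"
    then have m: "(a m < a (Suc m) \<and> b m < b (Suc m)) \<or> (a m = a (Suc m) \<and> b m = b (Suc m))" "m < p"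
      using c unfolding comonotone_def by auto
    show "(b (Suc m) - b m) / (a (Suc m) - a m) * max 0 (min (a k - a m) (a (Suc m) - a m)) =
        (if m < k then b (Suc m) - b m else 0)"
    proof (cases "m < k")
      case True
      then have "a (Suc m) \<le> a k" using comonotone_le[OF c _ k] by simp
      then show ?thesis using m True by auto
    next
      case False
      then have "a k \<le> a m" using comonotone_le[OF c, of k m] m by simp
      then show ?thesis using False by simp
    qed
  qed
  also have "\<dots> = (\<Sum>m<k. b (Suc m) - b m)"
    by (rule sum.mono_neutral_cong_right) (use k in auto)
  also have "\<dots> = b k - b 0" by (rule sum_lessThan_telescope)
  finally show ?thesis
    using comonotone_le[OF c, of 0 k] comonotone_le[OF c, of k p] k by (simp add: bend_def)
qed

lemma bend_strict_mono:
  assumes c: "comonotone p a b"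
  shows "strict_mono (bend p a b)"
proof (rule strict_monoI)
  fix y y' :: real assume lt: "y < y'"
  define g where "g m z = (b (Suc m) - b m) / (a (Suc m) - a m) * max 0 (min (z - a m) (a (Suc m) - a m))" for m z
  have le: "g m y \<le> g m y'" if "m < p" for m
  proof -
    have "0 \<le> (b (Suc m) - b m) / (a (Suc m) - a m)"
      using c that unfolding comonotone_def by (metis diff_ge_0_iff_ge divide_nonneg_nonneg less_imp_le order_refl)
    then show ?thesis unfolding g_def using lt by (intro mult_left_mono) auto
  qed
  have bend: "bend p a b z = b 0 + min (z - a 0) 0 + (\<Sum>m<p. g m z) + max (z - a p) 0" for z
    by (simp add: bend_def g_def)
  have sum: "(\<Sum>m<p. g m y) \<le> (\<Sum>m<p. g m y')" using le by (intro sum_mono) auto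
  consider "y < a 0" | "a p < y'" | "a 0 \<le> y" "y' \<le> a p" by linarith
  then show "bend p a b y < bend p a b y'"
  proof cases
    case 3
    \<comment> \<open>The last node not beyond y: the gap after it is nondegenerate, and its summand
      grows strictly from y to y'.\<close>
    define k where "k = (GREATEST m. m \<le> p \<and> a m \<le> y)"
    have k: "k \<le> p \<and> a k \<le> y" unfolding k_def
      by (rule GreatestI_nat[of _ 0 p]) (use 3 in auto)
    have "k \<noteq> p" using k 3 lt by auto
    then have kp: "k < p" using k by simp
    have "\<not> a (Suc k) \<le> y"
    proof
      assume "a (Suc k) \<le> y"
      then have "Suc k \<le> k" unfolding k_def
        by (intro Greatest_le_nat[of _ _ p]) (use kp k_def in auto)
      then show False by simp
    qed
    then have gap: "a k < a (Suc k)" "b k < b (Suc k)" using k c kp unfolding comonotone_def by auto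
    have "g k y < g k y'"
      unfolding g_def using gap k lt \<open>\<not> a (Suc k) \<le> y\<close>
      by (intro mult_strict_left_mono) (auto simp: max_def min_def)
    then have "(\<Sum>m<p. g m y) < (\<Sum>m<p. g m y')"
      using le kp by (intro sum_strict_mono_ex1) auto
    then show ?thesis unfolding bend using lt by (auto simp: max_def min_def)
  qed (use lt sum in \<open>auto simp: bend max_def min_def\<close>)
qed

lemma bend_left: "comonotone p a b \<Longrightarrow> y \<le> a 0 \<Longrightarrow> bend p a b y = b 0 + (y - a 0)"
proof -
  assume c: "comonotone p a b" and y: "y \<le> a 0"
  have "(\<Sum>m<p. (b (Suc m) - b m) / (a (Suc m) - a m) * max 0 (min (y - a m) (a (Suc m) - a m))) = 0"
  proof (rule sum.neutral, rule ballI)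
    fix m assume "m \<in> {..<p}"
    then have "y \<le> a m" using comonotone_le[OF c, of 0 m] y by auto
    then show "(b (Suc m) - b m) / (a (Suc m) - a m) * max 0 (min (y - a m) (a (Suc m) - a m)) = 0" by simp
  qed
  then show ?thesis using y comonotone_le[OF c, of 0 p] by (simp add: bend_def)
qed

lemma bend_right_ge:
  assumes c: "comonotone p a b" and y: "a p \<le> y"
  shows "bend p a b y = bend p a b (a p) + (y - a p)"
proof -
  have "max 0 (min (y - a m) (a (Suc m) - a m)) = max 0 (min (a p - a m) (a (Suc m) - a m))" if "m < p" for m
    using comonotone_le[OF c, of "Suc m" p] that y by auto
  then show ?thesis using y comonotone_le[OF c, of 0 p] by (simp add: bend_def)
qed

text \<open>Where consecutive nodes collide the slope blows up or is the junk value \<^term>\<open>x / 0\<close>; the summand is still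
  continuous there because it lies between 0 and the vanishing height of the target gap.\<close>

lemma continuous_bend:
  fixes \<alpha> \<beta> :: "nat \<Rightarrow> 'a::t2_space \<Rightarrow> real"
  assumes \<alpha>: "\<And>m. m \<le> p \<Longrightarrow> continuous_on UNIV (\<alpha> m)" and \<beta>: "\<And>m. m \<le> p \<Longrightarrow> continuous_on UNIV (\<beta> m)"
    and y: "continuous_on UNIV y"
    and c: "\<And>x. comonotone p (\<lambda>m. \<alpha> m x) (\<lambda>m. \<beta> m x)"
  shows "continuous_on UNIV (\<lambda>x. bend p (\<lambda>m. \<alpha> m x) (\<lambda>m. \<beta> m x) (y x))"
proof -
  have "continuous_on UNIV (\<lambda>x. (\<beta> (Suc m) x - \<beta> m x) / (\<alpha> (Suc m) x - \<alpha> m x) *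
      max 0 (min (y x - \<alpha> m x) (\<alpha> (Suc m) x - \<alpha> m x)))" (is "continuous_on _ ?g")
    if m: "m < p" for m
    unfolding continuous_on_eq_continuous_at[OF open_UNIV]
  proof
    fix x0 :: 'a
    have cont: "isCont (\<alpha> m) x0" "isCont (\<alpha> (Suc m)) x0" "isCont (\<beta> m) x0" "isCont (\<beta> (Suc m)) x0" "isCont y x0"
      using \<alpha>[of m] \<alpha>[of "Suc m"] \<beta>[of m] \<beta>[of "Suc m"] y m
      by (auto simp: continuous_on_eq_continuous_at)
    have cm: "(\<alpha> m x < \<alpha> (Suc m) x \<and> \<beta> m x < \<beta> (Suc m) x) \<or> (\<alpha> m x = \<alpha> (Suc m) x \<and> \<beta> m x = \<beta> (Suc m) x)" for x
      using c m unfolding comonotone_def by blast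
    show "isCont ?g x0"
    proof (cases "\<alpha> m x0 = \<alpha> (Suc m) x0")
      case False
      then show ?thesis using cont by (intro continuous_intros) auto
    next
      case True
      then have "\<beta> (Suc m) x0 - \<beta> m x0 = 0" using cm[of x0] by auto
      moreover have "((\<lambda>x. \<beta> (Suc m) x - \<beta> m x) \<longlongrightarrow> \<beta> (Suc m) x0 - \<beta> m x0) (at x0)"
        using cont by (intro tendsto_intros) (auto simp: isCont_def)
      ultimately have lim: "((\<lambda>x. \<beta> (Suc m) x - \<beta> m x) \<longlongrightarrow> 0) (at x0)" by simp
      have bd: "0 \<le> ?g x \<and> ?g x \<le> \<beta> (Suc m) x - \<beta> m x" for x
      proof (cases "\<alpha> m x = \<alpha> (Suc m) x")
        case True then show ?thesis using cm[of x] by auto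
      next
        case False
        then have pos: "0 < \<alpha> (Suc m) x - \<alpha> m x" "0 < \<beta> (Suc m) x - \<beta> m x" using cm[of x] by auto
        then have "?g x \<le> (\<beta> (Suc m) x - \<beta> m x) / (\<alpha> (Suc m) x - \<alpha> m x) * (\<alpha> (Suc m) x - \<alpha> m x)"
          by (intro mult_left_mono) auto
        then show ?thesis using pos by simp
      qed
      have "(?g \<longlongrightarrow> 0) (at x0)"
        by (rule tendsto_sandwich[OF _ _ tendsto_const lim]) (use bd in auto)
      then show ?thesis using True by (simp add: isCont_def)
    qed
  qed
  then have "continuous_on UNIV (\<lambda>x. \<Sum>m<p. (\<beta> (Suc m) x - \<beta> m x) / (\<alpha> (Suc m) x - \<alpha> m x) *
      max 0 (min (y x - \<alpha> m x) (\<alpha> (Suc m) x - \<alpha> m x)))"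
    by (intro continuous_on_sum) auto
  then show ?thesis
    unfolding bend_def by (intro continuous_on_add continuous_on_min continuous_on_max continuous_on_diff \<alpha> \<beta> y continuous_on_const) auto
qed

lemma bend_surj:
  assumes c: "comonotone p a b"
  shows "\<exists>y. bend p a b y = z"
proof -
  \<comment> \<open>Slope 1 beyond the end nodes brings the values at these points below and above
    z.\<close>
  let ?l = "a 0 - \<bar>z\<bar> - \<bar>b 0\<bar>" and ?r = "a p + \<bar>z\<bar> + \<bar>b p\<bar>"
  have "continuous_on UNIV (\<lambda>y. bend p a b y)"
    by (rule continuous_bend[where \<alpha> = "\<lambda>m _. a m" and \<beta> = "\<lambda>m _. b m"]) (use c in \<open>auto intro: continuous_intros\<close>)
  then have "continuous_on {?l..?r} (bend p a b)" by (rule continuous_on_subset) simp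
  moreover have "bend p a b ?l \<le> z" using bend_left[OF c, of ?l] by simp
  moreover have "z \<le> bend p a b ?r" using bend_right_ge[OF c, of ?r] bend_node[OF c, of p] by simp
  moreover have "?l \<le> ?r" using comonotone_le[OF c, of 0 p] by simp
  ultimately show ?thesis using IVT'[of "bend p a b" ?l z ?r] by blast
qed

section \<open>Order statistics of finitely many functions\<close>

lemma sorted_nth_filter:
  assumes "sorted xs" "m < length xs" and P: "\<And>y z. y \<le> z \<Longrightarrow> P z \<Longrightarrow> P y"
  shows "P (xs ! m) \<longleftrightarrow> m < length (filter P xs)"
  using assms(1,2)
proof (induction xs arbitrary: m)
  case (Cons y xs)
  show ?case
  proof (cases "P y")
    case True
    then show ?thesis using Cons by (cases m) auto
  next
    case False
    then have "\<not> P z" if "z \<in> set (y # xs)" for z using that Cons.prems(1) P by auto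
    then have "filter P (y # xs) = []" "\<not> P ((y # xs) ! m)"
      using Cons.prems(2) nth_mem[of m "y # xs"] by (auto simp: filter_empty_conv)
    then show ?thesis by simp
  qed
qed simp

definition level :: "nat \<Rightarrow> (nat \<Rightarrow> real \<Rightarrow> real) \<Rightarrow> nat \<Rightarrow> real \<Rightarrow> real" where
  "level n f m x = sort (map (\<lambda>i. f i x) [0..<n]) ! m"

text \<open>The entries satisfying a downward closed predicate form a prefix of the sorted list, so
  comparing a level with a threshold becomes counting.\<close>

lemma level_iff:
  assumes "m < n" and P: "\<And>y z. y \<le> z \<Longrightarrow> P z \<Longrightarrow> P y"
  shows "P (level n f m x) \<longleftrightarrow> m < card {i. i < n \<and> P (f i x)}"
proof -
  let ?xs = "map (\<lambda>i. f i x) [0..<n]"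
  have "P (level n f m x) \<longleftrightarrow> m < length (filter P (sort ?xs))"
    unfolding level_def by (rule sorted_nth_filter) (use assms in auto)
  also have "length (filter P (sort ?xs)) = length (filter P ?xs)"
    by (metis mset_filter mset_sort size_mset)
  also have "\<dots> = card {i. i < n \<and> P (f i x)}"
    by (subst length_filter_conv_card) (rule arg_cong[where f = card], auto)
  finally show ?thesis .
qed

text \<open>The finitely many strict inequalities between \<open>f i x0\<close> and c persist near
  x0, so the counts in \<open>level_iff\<close> move only in the favourable direction.\<close>

lemma continuous_level:
  assumes f: "\<And>i. i < n \<Longrightarrow> continuous_on UNIV (f i)" and m: "m < n"
  shows "continuous_on UNIV (level n f m)"
  unfolding continuous_on_def
proof
  fix x0 :: real
  have lim: "(f i \<longlongrightarrow> f i x0) (at x0 within UNIV)" if "i < n" for i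
    using f[OF that] by (simp add: continuous_on_def)
  show "(level n f m \<longlongrightarrow> level n f m x0) (at x0 within UNIV)"
  proof (rule order_tendstoI)
    fix c assume "level n f m x0 < c"
    then have c: "m < card {i. i < n \<and> f i x0 < c}" by (subst (asm) level_iff[OF m, of "\<lambda>y. y < c"]) auto
    have "\<forall>\<^sub>F x in at x0 within UNIV. \<forall>i\<in>{i. i < n \<and> f i x0 < c}. f i x < c"
      by (intro eventually_ball_finite ballI) (auto intro: order_tendstoD(2)[OF lim])
    then show "\<forall>\<^sub>F x in at x0 within UNIV. level n f m x < c"
    proof eventually_elim
      case (elim x)
      then have "card {i. i < n \<and> f i x0 < c} \<le> card {i. i < n \<and> f i x < c}" by (intro card_mono) auto
      then show ?case using c by (subst level_iff[OF m, of "\<lambda>y. y < c"]) auto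
    qed
  next
    fix c assume "c < level n f m x0"
    then have c: "\<not> m < card {i. i < n \<and> f i x0 \<le> c}" by (subst level_iff[OF m, of "\<lambda>y. y \<le> c", symmetric]) auto
    have "\<forall>\<^sub>F x in at x0 within UNIV. \<forall>i\<in>{i. i < n \<and> c < f i x0}. c < f i x"
      by (intro eventually_ball_finite ballI) (auto intro: order_tendstoD(1)[OF lim])
    then show "\<forall>\<^sub>F x in at x0 within UNIV. c < level n f m x"
    proof eventually_elim
      case (elim x)
      have "card {i. i < n \<and> f i x \<le> c} \<le> card {i. i < n \<and> f i x0 \<le> c}"
        using elim by (intro card_mono) (auto simp: not_less[symmetric])
      then have "\<not> m < card {i. i < n \<and> f i x \<le> c}" using c by simp
      then have "\<not> level n f m x \<le> c" by (subst level_iff[OF m, of "\<lambda>y. y \<le> c"]) auto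
      then show ?case by simp
    qed
  qed
qed

text \<open>Two keys inducing the same weak order are sorted by one and the same permutation, with
  ties in the same places.\<close>

lemma joint_sorting:
  fixes u v :: "'k \<Rightarrow> real"
  assumes "\<And>k l. k \<in> set ks \<Longrightarrow> l \<in> set ks \<Longrightarrow> u k \<le> u l \<longleftrightarrow> v k \<le> v l"
  obtains ps where "mset ps = mset ks" "sort (map u ks) = map u ps" "sort (map v ks) = map v ps"
    "comonotone (length ks - 1) (\<lambda>m. u (ps ! m)) (\<lambda>m. v (ps ! m))"
proof
  define ps where "ps = sort_key u ks"
  show ms: "mset ps = mset ks" by (simp add: ps_def)
  then have set: "set ps = set ks" by (rule mset_eq_setD)
  have su: "sorted (map u ps)" by (simp add: ps_def)
  have sv: "sorted (map v ps)"
    using sorted_wrt_mono_rel[of ps "\<lambda>x y. u x \<le> u y" "\<lambda>x y. v x \<le> v y"] su assms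
    unfolding sorted_map set[symmetric] by blast
  show "sort (map u ks) = map u ps" by (rule properties_for_sort[OF _ su]) (simp add: ms)
  show "sort (map v ks) = map v ps" by (rule properties_for_sort[OF _ sv]) (simp add: ms)
  have len: "length ps = length ks" using ms by (metis size_mset)
  show "comonotone (length ks - 1) (\<lambda>m. u (ps ! m)) (\<lambda>m. v (ps ! m))"
    unfolding comonotone_def
  proof (intro allI impI)
    fix m assume "m < length ks - 1"
    then have m: "m < length ps" "Suc m < length ps" using len by auto
    then have mem: "ps ! m \<in> set ks" "ps ! Suc m \<in> set ks" using set nth_mem by blast+
    have "u (ps ! m) \<le> u (ps ! Suc m)"
      using sorted_nth_mono[OF su, of m "Suc m"] m by simp
    then show "(u (ps ! m) < u (ps ! Suc m) \<and> v (ps ! m) < v (ps ! Suc m)) \<or>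
        (u (ps ! m) = u (ps ! Suc m) \<and> v (ps ! m) = v (ps ! Suc m))"
      using assms[OF mem] assms[OF mem(2,1)] by linarith
  qed
qed

text \<open>Interpolates between the jointly sorted values; it serves to align the crossing
  abscissae of two arrangements.\<close>

lemma time_change:
  fixes u v :: "'k \<Rightarrow> real"
  assumes "finite K" "\<And>k l. k \<in> K \<Longrightarrow> l \<in> K \<Longrightarrow> u k \<le> u l \<longleftrightarrow> v k \<le> v l"
  obtains \<phi> where "continuous_on UNIV \<phi>" "strict_mono \<phi>" "surj \<phi>" "\<And>k. k \<in> K \<Longrightarrow> \<phi> (u k) = v k"
proof -
  obtain ks where ks: "set ks = K" using finite_list[OF assms(1)] by blast
  show thesis
  proof (cases "ks = []")
    case True
    then show thesis using ks by (intro that[of "\<lambda>x. x"]) (auto simp: strict_mono_def intro: continuous_intros)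
  next
    case False
    obtain ps where ps: "mset ps = mset ks" 
      and c: "comonotone (length ks - 1) (\<lambda>m. u (ps ! m)) (\<lambda>m. v (ps ! m))"
      using joint_sorting[of ks u v] assms(2) ks by metis
    let ?\<phi> = "bend (length ks - 1) (\<lambda>m. u (ps ! m)) (\<lambda>m. v (ps ! m))"
    show thesis
    proof (rule that)
      show "continuous_on UNIV ?\<phi>"
        by (rule continuous_bend[where \<alpha> = "\<lambda>m _. u (ps ! m)" and \<beta> = "\<lambda>m _. v (ps ! m)"])
          (use c in \<open>auto intro: continuous_intros\<close>)
      show "strict_mono ?\<phi>" by (rule bend_strict_mono[OF c])
      show "surj ?\<phi>" using bend_surj[OF c] by (metis surjI)
      fix k assume "k \<in> K"
      then have "k \<in> set ps" using ps ks by (metis mset_eq_setD)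
      then obtain m where "m < length ps" "ps ! m = k" by (metis in_set_conv_nth)
      moreover have "length ps = length ks" using ps by (metis size_mset)
      ultimately show "?\<phi> (u k) = v k" using bend_node[OF c, of m] by auto
    qed
  qed
qed

text \<open>On each vertical line, the sorted values of f are mapped to those of g and the map is extended
  piecewise linearly.\<close>

lemma arr_iso_if_same_order:
  fixes f g :: "nat \<Rightarrow> real \<Rightarrow> real"
  assumes f: "\<And>i. i < n \<Longrightarrow> continuous_on UNIV (f i)" and g: "\<And>i. i < n \<Longrightarrow> continuous_on UNIV (g i)"
    and \<phi>: "continuous_on UNIV \<phi>" "strict_mono \<phi>" "surj \<phi>"
    and order: "\<And>i j x. i < n \<Longrightarrow> j < n \<Longrightarrow> f i x \<le> f j x \<longleftrightarrow> g i (\<phi> x) \<le> g j (\<phi> x)"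
    and n: "n \<ge> 1"
  shows "arr_iso (f ` {..<n}) (g ` {..<n})"
proof -
  define H where "H = (\<lambda>p::real\<times>real. (\<phi> (fst p),
     bend (n - 1) (\<lambda>m. level n f m (fst p)) (\<lambda>m. level n g m (\<phi> (fst p))) (snd p)))"
  have sorting: "\<exists>ps. mset ps = mset [0..<n] \<and> comonotone (n - 1) (\<lambda>m. level n f m x) (\<lambda>m. level n g m (\<phi> x)) \<and>
      (\<forall>m<n. level n f m x = f (ps ! m) x \<and> level n g m (\<phi> x) = g (ps ! m) (\<phi> x))" for x
  proof -
    obtain ps where ps: "mset ps = mset [0..<n]" "sort (map (\<lambda>i. f i x) [0..<n]) = map (\<lambda>i. f i x) ps"
        "sort (map (\<lambda>i. g i (\<phi> x)) [0..<n]) = map (\<lambda>i. g i (\<phi> x)) ps"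
        "comonotone (length [0..<n] - 1) (\<lambda>m. f (ps ! m) x) (\<lambda>m. g (ps ! m) (\<phi> x))"
      by (rule joint_sorting[of "[0..<n]" "\<lambda>i. f i x" "\<lambda>i. g i (\<phi> x)"]) (use order in auto)
    have len: "length ps = n" using ps(1) by (metis size_mset length_upt diff_zero)
    then have lev: "\<forall>m<n. level n f m x = f (ps ! m) x \<and> level n g m (\<phi> x) = g (ps ! m) (\<phi> x)"
      using ps(2,3) by (simp add: level_def)
    have "comonotone (n - 1) (\<lambda>m. level n f m x) (\<lambda>m. level n g m (\<phi> x))"
      using ps(4) lev n by (simp add: comonotone_def)
    then show ?thesis using ps(1) lev by blast
  qed
  then have c: "comonotone (n - 1) (\<lambda>m. level n f m x) (\<lambda>m. level n g m (\<phi> x))" for x by blast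
  have "continuous_on UNIV H"
    unfolding H_def
    by (intro continuous_on_Pair continuous_bend c continuous_on_compose2[OF \<phi>(1)]
        continuous_on_compose2[OF continuous_level[OF f]] continuous_on_compose2[OF continuous_level[OF g]]
        continuous_intros) (use n in auto)
  moreover have "inj H"
  proof (rule injI)
    fix p q assume eq: "H p = H q"
    then have "fst p = fst q" using \<phi>(2) by (auto simp: H_def strict_mono_eq)
    moreover have "snd p = snd q"
      using eq \<open>fst p = fst q\<close> strict_mono_eq[OF bend_strict_mono[OF c]] by (auto simp: H_def)
    ultimately show "p = q" by (rule prod_eqI)
  qed
  moreover have "surj H"
    unfolding surj_def
  proof
    fix q :: "real \<times> real"
    obtain x where x: "\<phi> x = fst q" using \<phi>(3) by (metis surjD)
    obtain y where "bend (n - 1) (\<lambda>m. level n f m x) (\<lambda>m. level n g m (\<phi> x)) y = snd q"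
      using bend_surj[OF c] by blast
    then have "q = H (x, y)" using x by (simp add: H_def)
    then show "\<exists>p. q = H p" by blast
  qed
  \<comment> \<open>Invariance of domain supplies the continuity of the inverse.\<close>
  ultimately obtain k where k: "homeomorphism (UNIV :: (real \<times> real) set) UNIV H k"
    using invariance_of_domain_homeomorphism[of UNIV H] by auto
  have on: "H (x, f i x) = (\<phi> x, g i (\<phi> x))" if "i < n" for i x
  proof -
    obtain ps where ps: "mset ps = mset [0..<n]"
      "\<forall>m<n. level n f m x = f (ps ! m) x \<and> level n g m (\<phi> x) = g (ps ! m) (\<phi> x)"
      using sorting by blast
    have "i \<in> set ps" using that mset_eq_setD[OF ps(1)] by simp
    then obtain m where m: "m < length ps" "ps ! m = i" by (metis in_set_conv_nth)
    have "length ps = n" using ps(1) by (metis size_mset length_upt diff_zero)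
    then show ?thesis using bend_node[OF c, of m x] ps(2) m by (auto simp: H_def)
  qed
  have "H ` graph (f i) = graph (g i)" if "i < n" for i
  proof -
    have "graph (g i) = (\<lambda>x. (\<phi> x, g i (\<phi> x))) ` UNIV"
      using \<phi>(3) unfolding graph_def by (auto simp: image_iff)
    moreover have "graph (f i) = (\<lambda>x. (x, f i x)) ` UNIV" unfolding graph_def by auto
    ultimately show ?thesis using on[OF that] by (simp add: image_image)
  qed
  then have "(\<lambda>f. H ` graph f) ` f ` {..<n} = graph ` g ` {..<n}" by (simp add: image_image)
  then show ?thesis unfolding arr_iso_def using k by blast
qed

section \<open>Combinatorial data determining an isomorphism class\<close>

definition crossing_data :: "nat \<Rightarrow> (nat \<Rightarrow> real \<Rightarrow> real) \<Rightarrow> (nat \<Rightarrow> nat \<Rightarrow> real) \<Rightarrow> (nat \<Rightarrow> nat \<Rightarrow> bool) \<Rightarrow> bool" where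
  "crossing_data n f \<tau> r \<longleftrightarrow> (\<forall>i<n. \<forall>j<n. i \<noteq> j \<longrightarrow>
     (\<forall>x. f i x \<le> f j x \<longleftrightarrow> (if r i j then x \<le> \<tau> i j else \<tau> i j \<le> x)))"

lemma cross_once_data:
  assumes "cross_once u v"
  shows "\<exists>t b. \<forall>x. u x \<le> v x \<longleftrightarrow> (if b then x \<le> t else t \<le> x)"
proof -
  obtain t where t: "u t = v t"
    and "((\<forall>y<t. u y < v y) \<and> (\<forall>y>t. u y > v y)) \<or> ((\<forall>y<t. u y > v y) \<and> (\<forall>y>t. u y < v y))"
    using assms unfolding cross_once_def by blast
  then consider "\<forall>y<t. u y < v y" "\<forall>y>t. u y > v y" | "\<forall>y<t. u y > v y" "\<forall>y>t. u y < v y" by blast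
  then show ?thesis
  proof cases
    case 1
    then have "u x \<le> v x \<longleftrightarrow> x \<le> t" for x
      using t by (cases x t rule: linorder_cases) (auto simp: less_imp_le not_le)
    then show ?thesis by (intro exI[of _ t] exI[of _ True]) simp
  next
    case 2
    then have "u x \<le> v x \<longleftrightarrow> t \<le> x" for x
      using t by (cases x t rule: linorder_cases) (auto simp: less_imp_le not_le)
    then show ?thesis by (intro exI[of _ t] exI[of _ False]) simp
  qed
qed

lemma simple_arrangement_data:
  assumes "simple_arrangement A" "card A = n"
  shows "\<exists>f \<tau> r. A = f ` {..<n} \<and> (\<forall>i<n. continuous_on UNIV (f i)) \<and> crossing_data n f \<tau> r"
proof -
  have A: "finite A" "\<And>f. f \<in> A \<Longrightarrow> continuous_on UNIV f" "\<And>f g. f \<in> A \<Longrightarrow> g \<in> A \<Longrightarrow> f \<noteq> g \<Longrightarrow> cross_once f g"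
    using assms unfolding simple_arrangement_def arrangement_def pseudoline_def by blast+
  obtain f where "bij_betw f {0..<n} A" using ex_bij_betw_nat_finite[OF A(1)] assms(2) by blast
  then have f: "inj_on f {..<n}" "A = f ` {..<n}" by (auto simp: bij_betw_def lessThan_atLeast0)
  have "\<exists>t b. i < n \<and> j < n \<and> i \<noteq> j \<longrightarrow> (\<forall>x. f i x \<le> f j x \<longleftrightarrow> (if b then x \<le> t else t \<le> x))" for i j
  proof (cases "i < n \<and> j < n \<and> i \<noteq> j")
    case True
    then have "f i \<noteq> f j" using f(1) by (auto simp: inj_on_def)
    then show ?thesis using cross_once_data[OF A(3), of "f i" "f j"] f(2) True by auto
  qed auto
  then obtain \<tau> r where
    "\<forall>i j. i < n \<and> j < n \<and> i \<noteq> j \<longrightarrow> (\<forall>x. f i x \<le> f j x \<longleftrightarrow> (if r i j then x \<le> \<tau> i j else \<tau> i j \<le> x))"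
    by metis
  then have "crossing_data n f \<tau> r" by (simp add: crossing_data_def)
  then show ?thesis using f A(2) by blast
qed

text \<open>A time change matches the crossing abscissae; with equal starting sides the pseudolines
  then have the same vertical order above corresponding abscissae.\<close>

lemma arr_iso_if_same_crossings:
  assumes f: "\<And>i. i < n \<Longrightarrow> continuous_on UNIV (f i)" "crossing_data n f \<tau> r"
    and g: "\<And>i. i < n \<Longrightarrow> continuous_on UNIV (g i)" "crossing_data n g \<sigma> s"
    and rs: "\<And>i j. i < n \<Longrightarrow> j < n \<Longrightarrow> r i j \<longleftrightarrow> s i j"
    and ord: "\<And>i j k l. i < n \<Longrightarrow> j < n \<Longrightarrow> k < n \<Longrightarrow> l < n \<Longrightarrow> \<tau> i j \<le> \<tau> k l \<longleftrightarrow> \<sigma> i j \<le> \<sigma> k l"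
    and n: "n \<ge> 1"
  shows "arr_iso (f ` {..<n}) (g ` {..<n})"
proof -
  obtain \<phi> where \<phi>: "continuous_on UNIV \<phi>" "strict_mono \<phi>" "surj \<phi>"
    and \<phi>\<tau>: "\<And>k. k \<in> {..<n} \<times> {..<n} \<Longrightarrow> \<phi> (\<tau> (fst k) (snd k)) = \<sigma> (fst k) (snd k)"
    by (rule time_change[of "{..<n} \<times> {..<n}" "\<lambda>k. \<tau> (fst k) (snd k)" "\<lambda>k. \<sigma> (fst k) (snd k)"])
      (use ord in auto)
  have eq: "\<phi> (\<tau> i j) = \<sigma> i j" if "i < n" "j < n" for i j using \<phi>\<tau>[of "(i,j)"] that by simp
  have order: "f i x \<le> f j x \<longleftrightarrow> g i (\<phi> x) \<le> g j (\<phi> x)" if ij: "i < n" "j < n" for i j x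
  proof (cases "i = j")
    case False
    then have "f i x \<le> f j x \<longleftrightarrow> (if r i j then x \<le> \<tau> i j else \<tau> i j \<le> x)"
      using f(2) ij unfolding crossing_data_def by blast
    also have "\<dots> \<longleftrightarrow> (if s i j then \<phi> x \<le> \<sigma> i j else \<sigma> i j \<le> \<phi> x)"
      using rs[OF ij] strict_mono_less_eq[OF \<phi>(2)] by (simp add: eq[OF ij, symmetric])
    also have "\<dots> \<longleftrightarrow> g i (\<phi> x) \<le> g j (\<phi> x)"
      using g(2) ij False unfolding crossing_data_def by blast
    finally show ?thesis .
  qed simp
  show ?thesis by (rule arr_iso_if_same_order[OF _ _ \<phi>]) (use n in \<open>simp_all add: f(1) g(1) order\<close>)
qed

text \<open>The invariant \<open>I\<close> collects the starting sides and the weak order of all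
  crossing abscissae. It may separate isomorphic arrangements, but it takes finitely many values and
  determines the class.\<close>

lemma finite_iso_classes: "finite (iso_classes n)"
proof (cases "n = 0")
  case True
  have "A = {}" if "simple_arrangement A" "card A = 0" for A
    using that by (simp add: simple_arrangement_def arrangement_def)
  then have "iso_classes n \<subseteq> {iso_class n {}}" using True unfolding iso_classes_def by auto
  then show ?thesis by (rule finite_subset) simp
next
  case False
  define \<A> where "\<A> = {A. simple_arrangement A \<and> card A = n}"
  have "\<forall>A\<in>\<A>. \<exists>D. A = fst D ` {..<n} \<and> (\<forall>i<n. continuous_on UNIV (fst D i)) \<and>
      crossing_data n (fst D) (fst (snd D)) (snd (snd D))"
    unfolding \<A>_def using simple_arrangement_data by (metis (mono_tags, lifting) fst_conv mem_Collect_eq snd_conv)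
  then obtain D where D: "\<forall>A\<in>\<A>. A = fst (D A) ` {..<n} \<and> (\<forall>i<n. continuous_on UNIV (fst (D A) i)) \<and>
      crossing_data n (fst (D A)) (fst (snd (D A))) (snd (snd (D A)))"
    by (rule bchoice[THEN exE])
  define f where "f A = fst (D A)" for A
  define \<tau> where "\<tau> A = fst (snd (D A))" for A
  define r where "r A = snd (snd (D A))" for A
  have d: "A = f A ` {..<n}" "\<And>i. i < n \<Longrightarrow> continuous_on UNIV (f A i)" "crossing_data n (f A) (\<tau> A) (r A)"
    if "A \<in> \<A>" for A
    using D that by (auto simp: f_def \<tau>_def r_def)
  define I where "I A = ({(i,j). i < n \<and> j < n \<and> r A i j},
    {((i,j),(k,l)). i < n \<and> j < n \<and> k < n \<and> l < n \<and> \<tau> A i j \<le> \<tau> A k l})" for A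
  have iso: "iso_class n A = iso_class n A'" if A: "A \<in> \<A>" "A' \<in> \<A>" "I A = I A'" for A A'
  proof (rule iso_class_eq)
    have e: "{(i,j). i < n \<and> j < n \<and> r A i j} = {(i,j). i < n \<and> j < n \<and> r A' i j}"
      "{((i,j),(k,l)). i < n \<and> j < n \<and> k < n \<and> l < n \<and> \<tau> A i j \<le> \<tau> A k l} =
       {((i,j),(k,l)). i < n \<and> j < n \<and> k < n \<and> l < n \<and> \<tau> A' i j \<le> \<tau> A' k l}"
      using A(3) unfolding I_def by (simp_all only: prod.inject)
    have "arr_iso (f A ` {..<n}) (f A' ` {..<n})"
    proof (rule arr_iso_if_same_crossings[OF d(2,3)[OF A(1)] d(2,3)[OF A(2)]])
      show "r A i j \<longleftrightarrow> r A' i j" if "i < n" "j < n" for i j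
        using eqset_imp_iff[OF e(1), of "(i,j)"] that by simp
      show "\<tau> A i j \<le> \<tau> A k l \<longleftrightarrow> \<tau> A' i j \<le> \<tau> A' k l" if "i < n" "j < n" "k < n" "l < n" for i j k l
        using eqset_imp_iff[OF e(2), of "((i,j),(k,l))"] that by simp
      show "1 \<le> n" using False by simp
    qed
    then show "arr_iso A A'" using d(1)[OF A(1)] d(1)[OF A(2)] by simp
  qed
  have "I A \<in> Pow ({..<n} \<times> {..<n}) \<times> Pow (({..<n} \<times> {..<n}) \<times> ({..<n} \<times> {..<n}))" for A
    unfolding I_def by auto
  then have "I ` \<A> \<subseteq> Pow ({..<n} \<times> {..<n}) \<times> Pow (({..<n} \<times> {..<n}) \<times> ({..<n} \<times> {..<n}))" by blast
  then have fin: "finite (I ` \<A>)" by (rule finite_subset) simp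
  have "iso_classes n \<subseteq> (\<lambda>c. iso_class n (inv_into \<A> I c)) ` I ` \<A>"
    unfolding iso_classes_def \<A>_def[symmetric]
  proof clarify
    fix A assume A: "A \<in> \<A>"
    then have "inv_into \<A> I (I A) \<in> \<A>" "I (inv_into \<A> I (I A)) = I A"
      by (auto intro: inv_into_into f_inv_into_f)
    then have "iso_class n A = iso_class n (inv_into \<A> I (I A))" using iso A by metis
    then show "iso_class n A \<in> (\<lambda>c. iso_class n (inv_into \<A> I c)) ` I ` \<A>" using A by blast
  qed
  then show ?thesis by (rule finite_subset) (intro finite_imageI fin)
qed

section \<open>The lower bound for \<open>B\<close>\<close>

lemma B_ge:
  "2 powr (0.2084 * (real n)\<^sup>2 - (real n * log 2 (real n) + 6 * real n)) \<le> real (B n)"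
proof -
  have "(real n) ^ n = 2 powr (real n * log 2 (real n))"
    \<comment> \<open>For n = 0 both sides are 1, as the factor \<open>real n\<close> makes the
      exponent 0.\<close>
    by (cases "n = 0") (simp_all add: powr_powr[symmetric] mult.commute[of "real n"] powr_realpow)
  moreover have "(2::real) ^ n = 2 powr real n" by (simp add: powr_realpow)
  ultimately have "real (n ^ n * 2 ^ n) = 2 powr (real n * log 2 (real n) + real n)" by (simp add: powr_add)
  moreover have "real (card (order_types n)) \<le> real (B n) * real (n ^ n * 2 ^ n)"
    using card_order_types_le[OF finite_iso_classes] by (metis of_nat_le_iff of_nat_mult)
  ultimately have "2 powr (0.2084 * (real n)\<^sup>2 - 5 * real n) \<le> real (B n) * 2 powr (real n * log 2 (real n) + real n)"
    using card_order_types_ge[of n] by simp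
  then have "2 powr (0.2084 * (real n)\<^sup>2 - 5 * real n) / 2 powr (real n * log 2 (real n) + real n) \<le> real (B n)"
    by (simp add: divide_le_eq)
  moreover have "0.2084 * (real n)\<^sup>2 - (real n * log 2 (real n) + 6 * real n) =
      (0.2084 * (real n)\<^sup>2 - 5 * real n) - (real n * log 2 (real n) + real n)" by simp
  ultimately show ?thesis by (simp only: powr_diff)
qed

theorem theorem1:
  shows "(\<exists>c::real. c > 0.2083 \<and>
            (\<exists>g \<in> O(\<lambda>n. real n * log 2 (real n)).
               \<forall>n. real (B n) \<ge> 2 powr (c * (real n)\<^sup>2 - g n)))
         \<and> (\<forall>\<^sub>F n in at_top. real (B n) \<ge> 2 powr (0.2083 * (real n)\<^sup>2))"
proof
  have "(\<lambda>n. real n * log 2 (real n) + 6 * real n) \<in> O(\<lambda>n. real n * log 2 (real n))"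
    by real_asymp
  then show "\<exists>c::real. c > 0.2083 \<and> (\<exists>g \<in> O(\<lambda>n. real n * log 2 (real n)).
      \<forall>n. real (B n) \<ge> 2 powr (c * (real n)\<^sup>2 - g n))"
    using B_ge by (intro exI[of _ "0.2084"] conjI bexI[of _ "\<lambda>n. real n * log 2 (real n) + 6 * real n"]) auto
  \<comment> \<open>The surplus of 0.0001 n^2 eventually exceeds n log n + 6n.\<close>
  have "\<forall>\<^sub>F n in at_top. 0.2083 * (real n)\<^sup>2 \<le> 0.2084 * (real n)\<^sup>2 - (real n * log 2 (real n) + 6 * real n)"
    by real_asymp
  then show "\<forall>\<^sub>F n in at_top. real (B n) \<ge> 2 powr (0.2083 * (real n)\<^sup>2)"
  proof eventually_elim
    case (elim n)
    then have "2 powr (0.2083 * (real n)\<^sup>2) \<le> 2 powr (0.2084 * (real n)\<^sup>2 - (real n * log 2 (real n) + 6 * real n))"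
      by (intro powr_mono) auto
    also have "\<dots> \<le> real (B n)" by (rule B_ge)
    finally show ?case .
  qed
qed

end
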